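(* Let $k \geq 2$, $V = (v_1, \dots, v_k) \in \mathbb{N}_0^k$, $B = (b_1, \dots, b_{k-1}) \in \mathbb{N}_0^{k-1}$ and let $\sigma$ be a permutation of $[k]$ such that, for any $1\le i<j\le k$, if $\sigma_i>\sigma_j$ then $v_{\sigma_j}\neq 0$. Then, when $\sigma_1 < \sigma_2$, $\mathcal{L}(G[V;B;\sigma])$ is equal to $$\sum_{\substack{M\in \mathbb{N}_0^{\sigma_2-\sigma_1} \\ 0 \leq \lVert M \rVert_1 \leq v_{\sigma_1}}} \mathcal{L}_M \cdot \binom{v_{\sigma_2} - 1 + v_{\sigma_1} - \lVert M \rVert_1}{v_{\sigma_1} - \lVert M \rVert_1} \prod_{i=1}^{\sigma_2-\sigma_1} \binom{b_{\sigma_1 - 1 + i} + m_i}{m_i},$$ where $\mathcal{L}_M = 1$ if $k=2$ and $\mathcal{L}_M = \mathcal{L}(G[f_{k,\sigma_1,\sigma_2,M}(V,B);\mathrm{Std}(\sigma_2\sigma_3\cdots \sigma_k)])$ otherwise; and, when $\sigma_2 < \sigma_1$, it is equal to $$\sum_{\substack{M \in \mathbb{N}_0^{\sigma_1-\sigma_2} \\ 0 \leq \lVert M \rVert_1 \leq v_{\sigma_2}-1}} \mathcal{L}'_M \cdot \binom{v_{\sigma_1} + v_{\sigma_2} - 1 - \lVert M \rVert_1}{v_{\sigma_2} - 1 - \lVert M \rVert_1} \prod_{i=1}^{\sigma_1-\sigma_2} \binom{b_{\sigma_2 - 1 + i} + m_i}{m_i},$$ where $\mathcal{L}'_M = 1$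 if $k = 2$ and $\mathcal{L}'_M = \mathcal{L}(G[f_{k,\sigma_2,\sigma_1,M}(V,B);\mathrm{Std}(\sigma_1\sigma_3\cdots \sigma_k)])$ otherwise. Here $M=(m_1,m_2,\dots)$.
   Context: $\mathbb{N}_0=\{0,1,2,\dots\}$, $[k]=\{1,\dots,k\}$, and $\sigma_i$ denotes the image of $i$ under the permutation $\sigma$. For $M=(m_1,\dots,m_r)\in\mathbb{N}_0^r$, $\lVert M\rVert_1=\sum_i m_i$. Convention: $\binom{-1}{0}=1$. $\mathcal{L}(P)$ is the number of linear extensions of a finite poset $P$ (total orders on its underlying set containing the partial order). For a word $z$ of distinct positive integers of length $r$, $\mathrm{Std}(z)$ is the permutation of $[r]$ obtained by replacing each entry by its rank among the entries of $z$. Posets $G[V;B;\sigma]$. Let $V=(v_1,\dots,v_k)\in\mathbb{N}_0^k$, $B=(b_1,\dots,b_{k-1})\in\mathbb{N}_0^{k-1}$ and let $\sigma$ be a permutation of $[k]$ such that for $i<j$, $\sigma_i>\sigma_j$ implies $v_{\sigma_j}\ne0$. $G[V;B;\sigma]$ is the poset built from $k$ disjoint chains, the $i$-th having $v_i+1$ elements, by requiring, for $1\le i<k$: the least element of the $i$-th chain is less than the least element of the $(i+1)$-th chain, with an additional chain of $b_i$ new elements lying between these two (greater than the first, less than the second); and the greatest element of the $\sigma_i$-th chain is less than the greatest element of the $\sigma_{i+1}$-th chain. The order is generated by these relations. The function $f_{k,n,l,M}$. Let $k\ge2$, $1\le n<l\le k$, and $M=(m_1,\dots,m_{l-n})\in\mathbb{N}_0^{l-n}$.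 Then $f_{k,n,l,M}:\mathbb{N}_0^k\times\mathbb{N}_0^{k-1}\to\mathbb{N}_0^{k-1}\times\mathbb{N}_0^{k-2}$ is the function (applied only where the entries below are nonnegative) such that the first coordinate of $f_{k,n,l,M}(V,B)$ is $$(v_1,\dots,v_{n-1},v_{n+1},\dots,v_{l-1},\,v_l+v_n-\lVert M\rVert_1,\,v_{l+1},\dots,v_k),$$ and the second coordinate is $$(b_2+m_2,\dots,b_{l-1}+m_{l-1},\,b_l,\dots,b_{k-1})\quad\text{when } n=1,$$ $$(b_1,\dots,b_{n-2},\,b_{n-1}+1+b_n+m_1,\,b_{n+1}+m_2,\dots,b_{l-1}+m_{l-n},\,b_l,\dots,b_{k-1})\quad\text{when } n>1.$$ *)

theory Defs
  imports Complex_Main "HOL-Combinatorics.Permutations"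
begin

text \<open>
  Tuples are lists; their entries are numbered from 1.
\<close>

abbreviation entry :: "'a list \<Rightarrow> nat \<Rightarrow> 'a" (infixl "!\<^sub>1" 100)
  where "xs !\<^sub>1 i \<equiv> xs ! (i - 1)"

text \<open>
  A finite poset is represented by its (reflexive) order relation, so that its underlying set is
  the field of the relation.
\<close>

definition linear_extensions :: "'a rel \<Rightarrow> 'a rel set"
  where "linear_extensions P = {R. linear_order_on (Field P) R \<and> P \<subseteq> R}"

definition \<L> :: "'a rel \<Rightarrow> nat"
  where "\<L> P = card (linear_extensions P)"

definition Std :: "nat list \<Rightarrow> nat \<Rightarrow> nat"
  where "Std z i = (if i \<in> {1..length z} then card {x \<in> set z. x \<le> z !\<^sub>1 i} else i)"

text \<open>
  \<open>Chain i j\<close> is the \<open>j\<close>-th element of the \<open>i\<close>-th chain, counted from \<open>j = 0\<close>, so \<open>Chain i 0\<close> is its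
  least and \<open>Chain i v\<^sub>i\<close> its greatest element. \<open>Link i j\<close> with \<open>1 \<le> j \<le> b\<^sub>i\<close> is the \<open>j\<close>-th of the
  new elements between the least elements of the chains \<open>i\<close> and \<open>i + 1\<close>.
\<close>

datatype node = Chain nat nat | Link nat nat

definition G_nodes :: "nat list \<Rightarrow> nat list \<Rightarrow> node set"
  where "G_nodes V B =
    {Chain i j | i j. i \<in> {1..length V} \<and> j \<le> V !\<^sub>1 i} \<union>
    {Link i j | i j. i \<in> {1..<length V} \<and> j \<in> {1..B !\<^sub>1 i}}"

definition G_gens :: "nat list \<Rightarrow> nat list \<Rightarrow> (nat \<Rightarrow> nat) \<Rightarrow> node rel"
  where "G_gens V B \<sigma> =
    {(Chain i j, Chain i (j + 1)) | i j. i \<in> {1..length V} \<and> j < V !\<^sub>1 i} \<union>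
    {(Chain i 0, Chain (i + 1) 0) | i. i \<in> {1..<length V}} \<union>
    {(Link i j, Link i (j + 1)) | i j. i \<in> {1..<length V} \<and> j \<in> {1..<B !\<^sub>1 i}} \<union>
    {(Chain i 0, Link i j) | i j. i \<in> {1..<length V} \<and> j \<in> {1..B !\<^sub>1 i}} \<union>
    {(Link i j, Chain (i + 1) 0) | i j. i \<in> {1..<length V} \<and> j \<in> {1..B !\<^sub>1 i}} \<union>
    {(Chain (\<sigma> i) (V !\<^sub>1 \<sigma> i), Chain (\<sigma> (i + 1)) (V !\<^sub>1 \<sigma> (i + 1))) | i. i \<in> {1..<length V}}"

definition G :: "nat list \<times> nat list \<Rightarrow> (nat \<Rightarrow> nat) \<Rightarrow> node rel"
  where "G VB \<sigma> = (case VB of (V, B) \<Rightarrow> Id_on (G_nodes V B) \<union> (G_gens V B \<sigma>)\<^sup>+)"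

lemma Field_G:
  assumes "\<sigma> permutes {1..length V}"
  shows "Field (G (V, B) \<sigma>) = G_nodes V B"
proof -
  have \<sigma>: "\<sigma> i \<in> {1..length V}" if "i \<in> {1..length V}" for i
    using that by (simp only: permutes_in_image[OF assms])
  have "G_gens V B \<sigma> \<subseteq> G_nodes V B \<times> G_nodes V B"
    using \<sigma> unfolding G_gens_def G_nodes_def by fastforce
  then have "(G_gens V B \<sigma>)\<^sup>+ \<subseteq> G_nodes V B \<times> G_nodes V B"
    by (rule trancl_subset_Sigma)
  then show ?thesis
    unfolding G_def Field_def by auto
qed

text \<open>
  The subtraction in the first coordinate is truncated; it is exact when \<open>\<parallel>M\<parallel>\<^sub>1 \<le> v\<^sub>l + v\<^sub>n\<close>, which
  is the only situation in which the function is to be used.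
\<close>

definition f :: "nat \<Rightarrow> nat \<Rightarrow> nat \<Rightarrow> nat list \<Rightarrow> nat list \<times> nat list \<Rightarrow> nat list \<times> nat list"
  where "f k n l M VB = (case VB of (V, B) \<Rightarrow>
    (map (\<lambda>i. V !\<^sub>1 i) [1..<n] @ map (\<lambda>i. V !\<^sub>1 i) [n + 1..<l] @
       [V !\<^sub>1 l + V !\<^sub>1 n - sum_list M] @ map (\<lambda>i. V !\<^sub>1 i) [l + 1..<k + 1],
     if n = 1
     then map (\<lambda>i. B !\<^sub>1 i + M !\<^sub>1 i) [2..<l] @ map (\<lambda>i. B !\<^sub>1 i) [l..<k]
     else map (\<lambda>i. B !\<^sub>1 i) [1..<n - 1] @ [B !\<^sub>1 (n - 1) + 1 + B !\<^sub>1 n + M !\<^sub>1 1] @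
       map (\<lambda>i. B !\<^sub>1 i + M !\<^sub>1 (i - n + 1)) [n + 1..<l] @ map (\<lambda>i. B !\<^sub>1 i) [l..<k]))"

text \<open>
  The binomial coefficient with the convention that \<open>-1\<close> over \<open>0\<close> is \<open>1\<close>. The upper argument is an
  integer because subtraction of naturals would replace \<open>-1\<close> by \<open>0\<close>; only values \<open>n \<ge> -1\<close> are
  meaningful.
\<close>

definition binom :: "int \<Rightarrow> nat \<Rightarrow> nat"
  where "binom n j = (if n = - 1 then (if j = 0 then 1 else 0) else nat n choose j)"

end

theory Submission
  imports Defs
begin

text \<open>
  Classify the linear extensions by the numbers \<open>m\<^sub>1, m\<^sub>2, \<dots>\<close> of elements of the chain \<open>n\<close> that lie
  between consecutive least elements of the chains \<open>n, n + 1, \<dots>, l\<close>. Once these elements are separated,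
  those in the \<open>i\<close>-th gap and the link elements there have the same relations to everything else, and
  the same is true of the elements of the chain \<open>n\<close> above the least element of the chain \<open>l\<close> and the
  inner elements of the chain \<open>l\<close>. Such an autonomous union of two disjoint chains may be replaced by
  a single chain at the cost of a binomial coefficient. What is left of the chain \<open>n\<close> is its least
  element, which becomes one more link element, or disappears as an initial segment if \<open>n = 1\<close>.

  The gaps are treated one after the other: \<open>P\<close> is the part of the chain \<open>n\<close> that is not yet merged.
\<close>

section \<open>Linear orders and lists\<close>

text \<open>Constraints are kept as plain relations, neither transitive nor reflexive. A linear
  order containing generators contains all they generate, so constraints are compared inside one
  linear order, and no transitive closure has to be computed after a merge. Merging puts elements of
  the chain \<open>n\<close> into links and into the chain \<open>l\<close>; chains and links are
  therefore lists over any type, and a system is identified with the standard one of the same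
  lengths only at the end.

  The two cases differ in what is pendant. If the top of the chain \<open>n\<close> is the lower
  one, all v_n elements above the least element of the chain \<open>n\<close> hang below the top of
  the chain \<open>l\<close>, next to v_l - 1 inner elements of that chain. If the top of the chain
  \<open>l\<close> is the lower one, the top of the chain \<open>n\<close> becomes a new top of the
  chain \<open>l\<close>: now v_n - 1 elements are pendant, next to v_l inner ones. The pendant
  number bounds the sum of M; what remains of it after the gaps, together with the inner number,
  gives the binomial coefficient. An inner number -1, that is v_l = 0 in the first case, is the
  origin of the convention for -1 over 0.\<close>

primrec rel_of :: "'a list \<Rightarrow> 'a rel"
  where "rel_of [] = {}"
  | "rel_of (x # xs) = {x} \<times> insert x (set xs) \<union> rel_of xs"

lemma rel_of_append: "rel_of (xs @ ys) = rel_of xs \<union> set xs \<times> set ys \<union> rel_of ys"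
  by (induction xs) auto

lemma rel_of_map: "rel_of (map h xs) = map_prod h h ` rel_of xs"
  by (induction xs) auto

lemma rel_of_subset: "rel_of xs \<subseteq> set xs \<times> set xs"
  by (induction xs) auto

lemma rel_ofD: "(x, y) \<in> rel_of xs \<Longrightarrow> x \<in> set xs \<and> y \<in> set xs"
  using rel_of_subset by fast

lemma refl_rel_of: "x \<in> set xs \<Longrightarrow> (x, x) \<in> rel_of xs"
  by (induction xs) auto

lemma rel_of_filter: "rel_of (filter Q xs) = rel_of xs \<inter> Collect Q \<times> Collect Q"
  by (induction xs) auto

text \<open>Totality is demanded also for \<open>x = y\<close>, which covers reflexivity on
  \<open>S\<close>.\<close>

lemma linear_order_on_iff:
  "linear_order_on S R \<longleftrightarrow> R \<subseteq> S \<times> S \<and> trans R \<and> antisym R \<and>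
     (\<forall>x\<in>S. \<forall>y\<in>S. (x, y) \<in> R \<or> (y, x) \<in> R)"
  unfolding order_on_defs total_on_def refl_on_def by (auto; metis)

lemma linear_order_on_Int:
  "linear_order_on S R \<Longrightarrow> D \<subseteq> S \<Longrightarrow> linear_order_on D (R \<inter> D \<times> D)"
  unfolding linear_order_on_iff trans_def antisym_def by (auto; metis subsetD)

text \<open>A pair of \<open>R'\<close> missing from \<open>R\<close> would be reversed in
  \<open>R\<close>, hence in \<open>R'\<close> as well, against antisymmetry.\<close>

lemma linear_order_on_subset_eq:
  assumes "linear_order_on S R" "linear_order_on S R'" "R \<subseteq> R'"
  shows "R = R'"
  using assms unfolding linear_order_on_iff antisym_def by blast

lemma linear_order_on_rel_of: "distinct xs \<Longrightarrow> linear_order_on (set xs) (rel_of xs)"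
proof (induction xs)
  case (Cons x xs)
  then have IH: "linear_order_on (set xs) (rel_of xs)" and "x \<notin> set xs"
    by auto
  have *: "(x, y) \<notin> rel_of xs" "(y, x) \<notin> rel_of xs" for y
    using \<open>x \<notin> set xs\<close> rel_of_subset by fast+
  have "trans (rel_of (x # xs))"
    using IH rel_ofD[of _ _ xs] * unfolding linear_order_on_iff trans_def by auto
  moreover have "antisym (rel_of (x # xs))"
    using IH * unfolding linear_order_on_iff antisym_def by auto
  moreover have "\<forall>a\<in>set (x # xs). \<forall>b\<in>set (x # xs). (a, b) \<in> rel_of (x # xs) \<or> (b, a) \<in> rel_of (x # xs)"
  proof -
    have "\<forall>a\<in>set xs. \<forall>b\<in>set xs. (a, b) \<in> rel_of xs \<or> (b, a) \<in> rel_of xs"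
      using IH unfolding linear_order_on_iff by (elim conjE)
    then show ?thesis by auto
  qed
  ultimately show ?case
    using rel_of_subset[of "x # xs"] unfolding linear_order_on_iff by (intro conjI)
qed simp

lemma linear_order_on_has_least:
  assumes "linear_order_on S R" "finite S" "S \<noteq> {}"
  shows "\<exists>m\<in>S. \<forall>x\<in>S. (m, x) \<in> R"
  using assms(2,3,1)
proof (induction S arbitrary: R rule: finite_ne_induct)
  case (singleton x)
  then show ?case by (auto simp: linear_order_on_iff)
next
  case (insert x F)
  have "linear_order_on F (R \<inter> F \<times> F)"
    using linear_order_on_Int[OF insert.prems, of F] by auto
  from insert.IH[OF this] obtain m where m: "m \<in> F" "\<forall>x\<in>F. (m, x) \<in> R"
    by blast
  have "(m, x) \<in> R \<or> (x, m) \<in> R" "trans R" "(x, x) \<in> R"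
    using insert.prems m by (auto simp: linear_order_on_iff)
  then show ?case
    using m unfolding trans_def by blast
qed

text \<open>The least element is taken out again and again. Lists as a normal form of finite linear
  orders make \<open>filter\<close> and \<open>shuffles\<close> available for counting.\<close>

lemma linear_order_on_imp_list:
  assumes "finite S" "linear_order_on S R"
  shows "\<exists>xs. distinct xs \<and> set xs = S \<and> rel_of xs = R"
  using assms
proof (induction "card S" arbitrary: S R)
  case 0
  then show ?case by (auto simp: linear_order_on_iff)
next
  case (Suc n)
  then obtain m where m: "m \<in> S" "\<forall>x\<in>S. (m, x) \<in> R"
    using linear_order_on_has_least[of S R] by fastforce
  let ?S = "S - {m}"
  have "n = card ?S" using Suc.hyps m Suc.prems by simp
  moreover have "linear_order_on ?S (R \<inter> ?S \<times> ?S)"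
    by (rule linear_order_on_Int) (use Suc.prems in auto)
  ultimately obtain xs where xs: "distinct xs" "set xs = ?S" "rel_of xs = R \<inter> ?S \<times> ?S"
    using Suc.hyps(1)[of ?S "R \<inter> ?S \<times> ?S"] Suc.prems(1) by auto
  have "(x, m) \<in> R \<Longrightarrow> x = m" for x
    using Suc.prems m unfolding linear_order_on_iff antisym_def by blast
  moreover have "R \<subseteq> S \<times> S"
    using Suc.prems by (simp add: linear_order_on_iff)
  ultimately have "R = {m} \<times> S \<union> R \<inter> ?S \<times> ?S"
    using m by auto
  moreover have "insert m ?S = S"
    using m by blast
  ultimately have "rel_of (m # xs) = R"
    using xs by simp
  moreover have "distinct (m # xs)" "set (m # xs) = S"
    using xs m by auto
  ultimately show ?case by blast
qed

text \<open>Each head is below the other, so they agree by antisymmetry; restricting to the tails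
  gives the induction step.\<close>

lemma rel_of_inject:
  "distinct xs \<Longrightarrow> distinct ys \<Longrightarrow> set xs = set ys \<Longrightarrow> rel_of xs = rel_of ys \<Longrightarrow> xs = ys"
proof (induction xs arbitrary: ys)
  case (Cons x xs)
  then obtain y ys' where ys: "ys = y # ys'"
    by (cases ys) auto
  have "(x, y) \<in> rel_of (x # xs)" "(y, x) \<in> rel_of (x # xs)"
    using Cons.prems ys by (auto simp: Cons.prems(4))
  moreover have "antisym (rel_of (x # xs))"
    using linear_order_on_rel_of[OF Cons.prems(1)] by (auto simp: linear_order_on_iff)
  ultimately have "x = y"
    unfolding antisym_def by blast
  have "set xs = set ys'"
    using Cons.prems \<open>x = y\<close> ys by auto
  moreover have "rel_of (x # xs) \<inter> set xs \<times> set xs = rel_of xs"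
      "rel_of (y # ys') \<inter> set ys' \<times> set ys' = rel_of ys'"
    using Cons.prems(1,2) ys rel_of_subset[of xs] rel_of_subset[of ys'] by auto
  ultimately have "rel_of xs = rel_of ys'"
    using Cons.prems(4) ys by metis
  then have "xs = ys'"
    using Cons.IH[of ys'] Cons.prems ys \<open>set xs = set ys'\<close> by auto
  then show ?case using ys \<open>x = y\<close> by simp
qed simp

section \<open>Linear extensions of arbitrary constraints\<close>

definition exts :: "'a set \<Rightarrow> 'a rel \<Rightarrow> 'a rel set"
  where "exts S Q = {R. linear_order_on S R \<and> Q \<subseteq> R}"

lemma finite_exts: "finite S \<Longrightarrow> finite (exts S Q)"
  by (rule finite_subset[of _ "Pow (S \<times> S)"]) (auto simp: exts_def linear_order_on_iff)

lemma extsD: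
  assumes "R \<in> exts S Q"
  shows "R \<subseteq> S \<times> S" "trans R" "antisym R" "\<And>x. x \<in> S \<Longrightarrow> (x, x) \<in> R"
    "\<And>x y. x \<in> S \<Longrightarrow> y \<in> S \<Longrightarrow> (x, y) \<in> R \<or> (y, x) \<in> R" "Q \<subseteq> R" "linear_order_on S R"
  using assms by (auto simp: exts_def linear_order_on_iff)

text \<open>\<open>Q\<close> and \<open>Q'\<close> need only agree modulo what transitivity,
  reflexivity and totality of a linear order supply. Changes of constraints below are justified in
  this way.\<close>

lemma exts_cong:
  assumes "\<And>R. linear_order_on S R \<Longrightarrow> Q \<subseteq> R \<longleftrightarrow> Q' \<subseteq> R"
  shows "exts S Q = exts S Q'"
  using assms by (auto simp: exts_def)

lemma linear_order_on_image:
  assumes "inj_on h S" "linear_order_on S R"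
  shows "linear_order_on (h ` S) (map_prod h h ` R)"
proof -
  have R: "R \<subseteq> S \<times> S" "trans R" "antisym R" "\<forall>x\<in>S. \<forall>y\<in>S. (x, y) \<in> R \<or> (y, x) \<in> R"
    using assms by (auto simp: linear_order_on_iff)
  have *: "h x = h y \<Longrightarrow> x \<in> S \<Longrightarrow> y \<in> S \<Longrightarrow> x = y" for x y
    using assms(1) by (auto dest: inj_onD)
  have iff: "(h x, h y) \<in> map_prod h h ` R \<longleftrightarrow> (x, y) \<in> R" if "x \<in> S" "y \<in> S" for x y
  proof
    assume "(h x, h y) \<in> map_prod h h ` R"
    then obtain x' y' where "(x', y') \<in> R" "h x = h x'" "h y = h y'"
      by auto
    moreover from this have "x' = x" "y' = y"
      using that R(1) * by blast+
    ultimately show "(x, y) \<in> R" by simp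
  qed force
  have sub: "map_prod h h ` R \<subseteq> h ` S \<times> h ` S"
    using R(1) by auto
  have "trans (map_prod h h ` R)"
  proof (rule transI)
    fix a b c assume "(a, b) \<in> map_prod h h ` R" and "(b, c) \<in> map_prod h h ` R"
    then obtain x y y' z where xy: "(x, y) \<in> R" "a = h x" "b = h y"
      and yz: "(y', z) \<in> R" "b = h y'" "c = h z"
      by auto
    have "y = y'"
      using * xy yz R(1) by blast
    then have "(x, z) \<in> R"
      using R(2) xy(1) yz(1) by (meson transD)
    then show "(a, c) \<in> map_prod h h ` R"
      using xy yz by auto
  qed
  moreover have "antisym (map_prod h h ` R)"
  proof (rule antisymI)
    fix a b assume "(a, b) \<in> map_prod h h ` R" and "(b, a) \<in> map_prod h h ` R"
    then obtain x y x' y' where xy: "(x, y) \<in> R" "a = h x" "b = h y"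
      and yx: "(y', x') \<in> R" "b = h y'" "a = h x'"
      by auto
    have "y = y'" "x = x'"
      using * xy yx R(1) by blast+
    then show "a = b"
      using R(3) xy yx by (metis antisymD)
  qed
  moreover have "\<forall>a\<in>h ` S. \<forall>b\<in>h ` S. (a, b) \<in> map_prod h h ` R \<or> (b, a) \<in> map_prod h h ` R"
    using R(4) iff by simp
  ultimately show ?thesis
    using sub unfolding linear_order_on_iff by (intro conjI)
qed

lemma card_exts_image:
  assumes inj: "inj_on h S" and Q: "Q \<subseteq> S \<times> S"
  shows "card (exts (h ` S) (map_prod h h ` Q)) = card (exts S Q)"
proof -
  let ?g = "inv_into S h"
  have g: "?g (h x) = x" if "x \<in> S" for x
    using inj that by simp
  have inv: "map_prod ?g ?g ` map_prod h h ` R = R" if "R \<subseteq> S \<times> S" for R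
  proof -
    have "map_prod ?g ?g (map_prod h h z) = z" if "z \<in> R" for z
      using that \<open>R \<subseteq> S \<times> S\<close> g by (cases z) auto
    then show ?thesis by (simp add: image_image)
  qed
  have inv': "map_prod h h ` map_prod ?g ?g ` R = R" if "R \<subseteq> h ` S \<times> h ` S" for R
  proof -
    have "map_prod h h (map_prod ?g ?g z) = z" if "z \<in> R" for z
      using that \<open>R \<subseteq> h ` S \<times> h ` S\<close> f_inv_into_f[of _ h S] by (cases z) auto
    then show ?thesis by (simp add: image_image)
  qed
  have "bij_betw (\<lambda>R. map_prod h h ` R) (exts S Q) (exts (h ` S) (map_prod h h ` Q))"
  proof (rule bij_betw_byWitness[where f' = "\<lambda>R. map_prod ?g ?g ` R"])
    show "\<forall>R\<in>exts S Q. map_prod ?g ?g ` map_prod h h ` R = R"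
      by (intro ballI inv) (rule extsD(1))
    show "\<forall>R\<in>exts (h ` S) (map_prod h h ` Q). map_prod h h ` map_prod ?g ?g ` R = R"
      by (intro ballI inv') (rule extsD(1))
    show "(`) (map_prod h h) ` exts S Q \<subseteq> exts (h ` S) (map_prod h h ` Q)"
      using linear_order_on_image[OF inj] unfolding exts_def by blast
    have "inj_on ?g (h ` S)" "?g ` h ` S = S"
      using g by (auto simp: inj_on_def image_iff)
    note g = this
    show "(`) (map_prod ?g ?g) ` exts (h ` S) (map_prod h h ` Q) \<subseteq> exts S Q"
    proof (rule image_subsetI)
      fix R assume "R \<in> exts (h ` S) (map_prod h h ` Q)"
      then have R: "linear_order_on (h ` S) R" "map_prod h h ` Q \<subseteq> R"
        by (auto simp: exts_def)
      have "Q \<subseteq> map_prod ?g ?g ` R"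
        using inv[OF Q] image_mono[OF R(2), of "map_prod ?g ?g"] by simp
      moreover have "linear_order_on S (map_prod ?g ?g ` R)"
        using linear_order_on_image[OF g(1) R(1)] g(2) by simp
      ultimately show "map_prod ?g ?g ` R \<in> exts S Q"
        by (simp add: exts_def)
    qed
  qed
  then show ?thesis by (simp add: bij_betw_same_card)
qed

lemma exts_eq_rel_of:
  "finite S \<Longrightarrow> exts S Q = rel_of ` {xs. distinct xs \<and> set xs = S \<and> Q \<subseteq> rel_of xs}"
  using linear_order_on_imp_list[of S] linear_order_on_rel_of by (fastforce simp: exts_def)

lemma card_exts_rel_of:
  assumes "distinct xs" "set xs = S"
  shows "card (exts S (rel_of xs)) = 1"
proof -
  have "exts S (rel_of xs) = {rel_of xs}"
    using linear_order_on_rel_of[OF assms(1)] assms linear_order_on_subset_eq[of S "rel_of xs"]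
    unfolding exts_def by blast
  then show ?thesis by simp
qed

section \<open>Autonomous subsets\<close>

text \<open>A duplicate-free list on \<open>S\<close> respects both orders iff filtering it to the
  two sets returns \<open>xs\<close> and \<open>ys\<close>, that is, iff it is a shuffle; and
  \<open>rel_of\<close> is injective on these lists.\<close>

lemma card_exts_two_chains:
  assumes "distinct (xs @ ys)" "S = set xs \<union> set ys"
  shows "card (exts S (rel_of xs \<union> rel_of ys)) = (length xs + length ys) choose length xs"
proof -
  have d: "distinct xs" "distinct ys" "set xs \<inter> set ys = {}"
    using assms by auto
  let ?Z = "{zs. distinct zs \<and> set zs = S \<and> rel_of xs \<union> rel_of ys \<subseteq> rel_of zs}"
  \<comment> \<open>The filtered list carries a linear order on the same set that contains
    \<open>rel_of us\<close>; such orders coincide, and so do their lists.\<close>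
  have filter: "filter (\<lambda>x. x \<in> set us) zs = us"
    if "distinct us" "set us \<subseteq> set zs" "rel_of us \<subseteq> rel_of zs" "distinct zs" for us zs :: "'a list"
  proof (rule rel_of_inject)
    let ?f = "filter (\<lambda>x. x \<in> set us) zs"
    show s: "set ?f = set us" "distinct ?f" "distinct us" using that by auto
    have "rel_of us \<subseteq> rel_of ?f"
      using that rel_of_subset[of us] by (auto simp: rel_of_filter)
    then show "rel_of ?f = rel_of us"
      using linear_order_on_rel_of[of us] linear_order_on_rel_of[of ?f] s
        linear_order_on_subset_eq by metis
  qed
  have "?Z = shuffles xs ys"
  proof (intro equalityI subsetI)
    fix zs assume zs: "zs \<in> ?Z"
    have "filter (\<lambda>x. x \<in> set xs) zs = xs"
      by (rule filter) (use zs assms d in auto)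
    moreover have "filter (\<lambda>x. x \<in> set ys) zs = ys"
      by (rule filter) (use zs assms d in auto)
    moreover have "filter (\<lambda>x. x \<notin> set xs) zs = filter (\<lambda>x. x \<in> set ys) zs"
      by (rule filter_cong) (use zs assms d in auto)
    ultimately show "zs \<in> shuffles xs ys"
      using partition_in_shuffles[of zs "\<lambda>x. x \<in> set xs"] by simp
  next
    fix zs assume zs: "zs \<in> shuffles xs ys"
    have "rel_of xs \<subseteq> rel_of zs" "rel_of ys \<subseteq> rel_of zs"
      using filter_shuffles_disjoint1[OF d(3) zs] filter_shuffles_disjoint2[OF d(3) zs]
        rel_of_filter[of _ zs] by (metis inf.cobounded1)+
    then show "zs \<in> ?Z"
      using distinct_disjoint_shuffles[OF d zs] set_shuffles[OF zs] assms(2) by auto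
  qed
  moreover have "inj_on rel_of ?Z"
    by (auto intro!: inj_onI rel_of_inject)
  ultimately show ?thesis
    using exts_eq_rel_of[of S "rel_of xs \<union> rel_of ys"] assms(2) card_disjoint_shuffles[OF d(3)]
    by (simp add: card_image)
qed

lemma exists_map_eq:
  "distinct us \<Longrightarrow> length us = length ts \<Longrightarrow> \<exists>g. map g us = ts"
proof (induction us arbitrary: ts)
  case (Cons u us)
  then obtain t ts' where ts: "ts = t # ts'"
    by (cases ts) auto
  then obtain g where "map g us = ts'"
    using Cons by auto
  with ts have "map (g(u := t)) (u # us) = ts"
    using Cons.prems by auto
  then show ?case by blast
qed simp

text \<open>Everything outside \<open>D\<close> is related to all of \<open>D\<close> alike:
  \<open>A\<close> from below, \<open>B\<close> from above. Classify the extensions by their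
  restriction to \<open>D\<close>. Each linear extension of \<open>C\<close> on \<open>D\<close>
  occurs equally often, since renaming the elements of \<open>D\<close> turns one class into
  another. The common size is expressed with an arbitrary list \<open>ts\<close>, so that
  \<open>D\<close> may become a chain in any convenient order.\<close>

lemma card_exts_autonomous:
  fixes D :: "'a set"
  assumes fin: "finite S" and D: "D \<subseteq> S"
    and Q: "Q \<subseteq> (S - D) \<times> (S - D)" and AB: "A \<subseteq> S - D" "B \<subseteq> S - D"
    and C: "C \<subseteq> D \<times> D" and ts: "distinct ts" "set ts = D"
  shows "card (exts S (Q \<union> A \<times> D \<union> D \<times> B \<union> C)) =
    card (exts D C) * card (exts S (Q \<union> A \<times> D \<union> D \<times> B \<union> rel_of ts))"
    (is "card (exts S (?Q \<union> C)) = _ * ?N")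
proof -
  have finD: "finite D" using fin D finite_subset by blast
  let ?X = "\<lambda>U. {R \<in> exts S ?Q. R \<inter> D \<times> D = U}"
  have "exts S (?Q \<union> C) = (\<Union>U\<in>exts D C. ?X U)"
    using C linear_order_on_Int[OF _ D] by (auto simp: exts_def)
  then have "card (exts S (?Q \<union> C)) = (\<Sum>U\<in>exts D C. card (?X U))"
    using finite_exts[OF fin] finite_exts[OF finD] by (simp, subst card_UN_disjoint) auto
  also have "\<dots> = (\<Sum>U\<in>exts D C. ?N)"
  proof (rule sum.cong[OF refl])
    fix U assume "U \<in> exts D C"
    then obtain us where us: "distinct us" "set us = D" "U = rel_of us"
      using exts_eq_rel_of[OF finD] by auto
    \<comment> \<open>Containing \<open>rel_of us\<close> already forces the restriction to
      \<open>D\<close> to be \<open>rel_of us\<close>.\<close>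
    have X: "?X U = exts S (?Q \<union> rel_of us)"
      using us rel_of_subset[of us] linear_order_on_rel_of[OF us(1)] linear_order_on_Int[OF _ D]
        linear_order_on_subset_eq[of D "rel_of us"]
      by (auto simp: exts_def) blast+
    have "length us = length ts"
      using us ts distinct_card by metis
    then obtain g where g: "map g us = ts"
      using exists_map_eq us(1) by blast
    \<comment> \<open>A permutation of \<open>D\<close> taking the list \<open>us\<close> to
      \<open>ts\<close>, extended by the identity; it maps each of \<open>S\<close>,
      \<open>Q\<close>, \<open>A\<close> and \<open>B\<close> onto itself.\<close>
    define h where "h = (\<lambda>x. if x \<in> D then g x else x)"
    have h: "map h us = ts"
      using g us(2) by (auto simp: h_def)
    have hD: "h ` D = D" "inj_on h D"
      using h us ts by (metis list.set_map, metis distinct_map)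
    have hS: "h x = x" if "x \<notin> D" for x
      using that by (simp add: h_def)
    have "h x \<in> D" if "x \<in> D" for x
      using hD(1) that by blast
    then have inj: "inj_on h S"
      using hD(2) hS unfolding inj_on_def by metis
    have im: "h ` (S - D) = S - D" "h ` A = A" "h ` B = B"
      using hS AB by (auto simp: image_iff subset_eq)
    have "S = D \<union> (S - D)"
      using D by blast
    then have "h ` S = S"
      using hD(1) im(1) image_Un[of h D "S - D"] by simp
    moreover have "map_prod h h z = z" if "z \<in> Q" for z
      using hS Q that by (cases z) auto
    then have "map_prod h h ` Q = Q"
      by (simp add: image_def)
    moreover have "map_prod h h ` (A \<times> D) = A \<times> D" "map_prod h h ` (D \<times> B) = D \<times> B"
      by (auto simp: map_prod_surj_on im hD)
    ultimately have "exts (h ` S) (map_prod h h ` (?Q \<union> rel_of us)) = exts S (?Q \<union> rel_of ts)"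
      by (simp only: image_Un rel_of_map[symmetric] h)
    moreover have "?Q \<union> rel_of us \<subseteq> S \<times> S"
      using Q AB D us rel_of_subset[of us] by blast
    ultimately show "card (?X U) = ?N"
      using card_exts_image[OF inj, of "?Q \<union> rel_of us"] X by simp
  qed
  finally show ?thesis by simp
qed

section \<open>Systems of chains and links\<close>

text \<open>Chains and links are lists over any type, since a merge moves elements of one chain into
  a link or into another chain.\<close>

definition nodes :: "nat \<Rightarrow> (nat \<Rightarrow> 'a list) \<Rightarrow> (nat \<Rightarrow> 'a list) \<Rightarrow> 'a set"
  where "nodes k c b = (\<Union>i\<in>{1..k}. set (c i)) \<union> (\<Union>i\<in>{1..<k}. set (b i))"

text \<open>\<open>ts\<close> lists the chains whose greatest elements are ordered; it may omit chains.\<close>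

definition constr :: "nat \<Rightarrow> (nat \<Rightarrow> 'a list) \<Rightarrow> (nat \<Rightarrow> 'a list) \<Rightarrow> nat list \<Rightarrow> 'a rel"
  where "constr k c b ts = (\<Union>i\<in>{1..k}. rel_of (c i)) \<union>
    (\<Union>i\<in>{1..<k}. rel_of (hd (c i) # b i @ [hd (c (Suc i))])) \<union>
    rel_of (map (\<lambda>i. last (c i)) ts)"

definition separated :: "nat \<Rightarrow> (nat \<Rightarrow> 'a list) \<Rightarrow> (nat \<Rightarrow> 'a list) \<Rightarrow> bool"
  where "separated k c b \<longleftrightarrow>
    (\<forall>i\<in>{1..k}. c i \<noteq> [] \<and> distinct (c i)) \<and> (\<forall>i\<in>{1..<k}. distinct (b i)) \<and>
    (\<forall>i\<in>{1..k}. \<forall>j\<in>{1..k}. i \<noteq> j \<longrightarrow> set (c i) \<inter> set (c j) = {}) \<and>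
    (\<forall>i\<in>{1..<k}. \<forall>j\<in>{1..<k}. i \<noteq> j \<longrightarrow> set (b i) \<inter> set (b j) = {}) \<and>
    (\<forall>i\<in>{1..k}. \<forall>j\<in>{1..<k}. set (c i) \<inter> set (b j) = {})"

lemma separatedD:
  assumes "separated k c b"
  shows "i \<in> {1..k} \<Longrightarrow> c i \<noteq> []" "i \<in> {1..k} \<Longrightarrow> distinct (c i)"
    "i \<in> {1..<k} \<Longrightarrow> distinct (b i)"
    "i \<in> {1..k} \<Longrightarrow> j \<in> {1..k} \<Longrightarrow> i \<noteq> j \<Longrightarrow> set (c i) \<inter> set (c j) = {}"
    "i \<in> {1..<k} \<Longrightarrow> j \<in> {1..<k} \<Longrightarrow> i \<noteq> j \<Longrightarrow> set (b i) \<inter> set (b j) = {}"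
    "i \<in> {1..k} \<Longrightarrow> j \<in> {1..<k} \<Longrightarrow> set (c i) \<inter> set (b j) = {}"
    "i \<in> {1..k} \<Longrightarrow> j \<in> {1..<k} \<Longrightarrow> set (b j) \<inter> set (c i) = {}"
  using assms unfolding separated_def by (simp_all only: Int_commute[of "set (b j)"] simp_thms)

definition std_chain :: "(nat \<Rightarrow> nat) \<Rightarrow> nat \<Rightarrow> node list"
  where "std_chain v i = map (Chain i) [0..<v i]"

definition std_link :: "(nat \<Rightarrow> nat) \<Rightarrow> nat \<Rightarrow> node list"
  where "std_link w i = map (Link i) [1..<Suc (w i)]"

text \<open>Here \<open>v i\<close> is the number of all elements of the chain \<open>i\<close>, one more than \<open>v\<^sub>i\<close>.\<close>

definition count_exts :: "nat \<Rightarrow> nat list \<Rightarrow> (nat \<Rightarrow> nat) \<Rightarrow> (nat \<Rightarrow> nat) \<Rightarrow> nat"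
  where "count_exts k ts v w =
    card (exts (nodes k (std_chain v) (std_link w)) (constr k (std_chain v) (std_link w) ts))"

section \<open>Systems up to renaming of their elements\<close>

lemma finite_nodes: "finite (nodes k c b)"
  by (simp add: nodes_def)

lemma nodesI:
  "i \<in> {1..k} \<Longrightarrow> x \<in> set (c i) \<Longrightarrow> x \<in> nodes k c b"
  "i \<in> {1..<k} \<Longrightarrow> x \<in> set (b i) \<Longrightarrow> x \<in> nodes k c b"
  unfolding nodes_def by blast+

lemma nodes_cong:
  assumes "\<And>i. i \<in> {1..k} \<Longrightarrow> c i = c' i" "\<And>i. i \<in> {1..<k} \<Longrightarrow> b i = b' i"
  shows "nodes k c b = nodes k c' b'"
  using assms by (simp add: nodes_def)

lemma constr_cong:
  assumes "\<And>i. i \<in> {1..k} \<Longrightarrow> c i = c' i" "\<And>i. i \<in> {1..<k} \<Longrightarrow> b i = b' i"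
    "set ts \<subseteq> {1..k}"
  shows "constr k c b ts = constr k c' b' ts"
proof -
  have "map (\<lambda>i. last (c i)) ts = map (\<lambda>i. last (c' i)) ts"
    using assms by auto
  moreover have "(\<Union>i\<in>{1..k}. rel_of (c i)) = (\<Union>i\<in>{1..k}. rel_of (c' i))"
    using assms(1) by simp
  moreover have "(\<Union>i\<in>{1..<k}. rel_of (hd (c i) # b i @ [hd (c (Suc i))])) =
      (\<Union>i\<in>{1..<k}. rel_of (hd (c' i) # b' i @ [hd (c' (Suc i))]))"
    using assms(1,2) by (intro SUP_cong refl) auto
  ultimately show ?thesis
    by (simp only: constr_def)
qed

lemma count_exts_cong:
  assumes "\<And>i. i \<in> {1..k} \<Longrightarrow> v i = v' i" "\<And>i. i \<in> {1..<k} \<Longrightarrow> w i = w' i"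
    "set ts \<subseteq> {1..k}"
  shows "count_exts k ts v w = count_exts k ts v' w'"
proof -
  have *: "std_chain v i = std_chain v' i" if "i \<in> {1..k}" for i
    using assms that by (simp add: std_chain_def)
  have **: "std_link w i = std_link w' i" if "i \<in> {1..<k}" for i
    using assms that by (simp add: std_link_def)
  have "nodes k (std_chain v) (std_link w) = nodes k (std_chain v') (std_link w')"
    "constr k (std_chain v) (std_link w) ts = constr k (std_chain v') (std_link w') ts"
    by (intro nodes_cong constr_cong * ** assms(3); assumption)+
  then show ?thesis by (simp add: count_exts_def)
qed

lemma constr_subset:
  assumes "\<And>i. i \<in> {1..k} \<Longrightarrow> c i \<noteq> []" "set ts \<subseteq> {1..k}"
  shows "constr k c b ts \<subseteq> nodes k c b \<times> nodes k c b"
proof -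
  have "rel_of (c i) \<subseteq> nodes k c b \<times> nodes k c b" if "i \<in> {1..k}" for i
    using that rel_of_subset[of "c i"] by (auto intro: nodesI)
  moreover have "rel_of (hd (c i) # b i @ [hd (c (Suc i))]) \<subseteq> nodes k c b \<times> nodes k c b"
    if "i \<in> {1..<k}" for i
  proof (rule order_trans[OF rel_of_subset])
    have "hd (c i) \<in> nodes k c b" "hd (c (Suc i)) \<in> nodes k c b"
      by (rule nodesI(1)[of i], use that assms in auto) (rule nodesI(1)[of "Suc i"], use that assms in auto)
    moreover have "set (b i) \<subseteq> nodes k c b"
      using that by (auto intro: nodesI)
    ultimately have "set (hd (c i) # b i @ [hd (c (Suc i))]) \<subseteq> nodes k c b"
      by simp
    then show "set (hd (c i) # b i @ [hd (c (Suc i))]) \<times> set (hd (c i) # b i @ [hd (c (Suc i))])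
        \<subseteq> nodes k c b \<times> nodes k c b"
      by blast
  qed
  moreover have "rel_of (map (\<lambda>i. last (c i)) ts) \<subseteq> nodes k c b \<times> nodes k c b"
  proof (rule order_trans[OF rel_of_subset])
    have "last (c i) \<in> nodes k c b" if "i \<in> set ts" for i
      by (rule nodesI(1)[of i]) (use that assms in auto)
    then show "set (map (\<lambda>i. last (c i)) ts) \<times> set (map (\<lambda>i. last (c i)) ts)
        \<subseteq> nodes k c b \<times> nodes k c b"
      by auto
  qed
  ultimately show ?thesis
    unfolding constr_def by blast
qed

lemma separated_std:
  "(\<And>i. i \<in> {1..k} \<Longrightarrow> v i > 0) \<Longrightarrow> separated k (std_chain v) (std_link w)"
  by (auto simp: separated_def std_chain_def std_link_def distinct_map inj_on_def)

text \<open>\<open>separated\<close> makes all listed elements distinct, so the system is isomorphic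
  to the standard one with the same lengths. After a merge this permits forgetting which elements a
  link or a chain was put together from.\<close>

lemma card_exts_system:
  assumes sep: "separated k c b" and ts: "set ts \<subseteq> {1..k}"
  shows "card (exts (nodes k c b) (constr k c b ts)) =
    count_exts k ts (\<lambda>i. length (c i)) (\<lambda>i. length (b i))"
proof -
  \<comment> \<open>\<open>Link\<close> nodes are counted from 1, list positions from 0.\<close>
  define h where "h x = (case x of Chain i j \<Rightarrow> c i ! j | Link i j \<Rightarrow> b i ! (j - 1))" for x
  let ?c = "std_chain (\<lambda>i. length (c i))" and ?b = "std_link (\<lambda>i. length (b i))"
  have c: "map h (?c i) = c i" for i
    by (simp add: std_chain_def h_def comp_def map_nth)
  have "map h (?b i) = map (\<lambda>j. b i ! (j - 1)) (map Suc [0..<length (b i)])" for i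
    by (simp add: std_link_def h_def map_Suc_upt del: upt_Suc)
  then have b: "map h (?b i) = b i" for i
    by (simp add: comp_def map_nth)
  have ne: "?c i \<noteq> []" "c i \<noteq> []" if "i \<in> {1..k}" for i
    using sep that by (auto simp: separated_def std_chain_def)
  have N: "h ` nodes k ?c ?b = nodes k c b"
    by (simp only: nodes_def image_Un image_UN set_map[symmetric] c b)
  have "map_prod h h ` rel_of (?c i) = rel_of (c i)" for i
    by (simp add: rel_of_map[symmetric] c)
  moreover have "map_prod h h ` rel_of (hd (?c i) # ?b i @ [hd (?c (Suc i))]) =
      rel_of (hd (c i) # b i @ [hd (c (Suc i))])" if "i \<in> {1..<k}" for i
    using ne[of i] ne[of "Suc i"] that hd_map[of "?c i" h] hd_map[of "?c (Suc i)" h]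
    by (simp add: rel_of_map[symmetric] c b del: rel_of.simps)
  moreover have "map_prod h h ` rel_of (map (\<lambda>i. last (?c i)) ts) = rel_of (map (\<lambda>i. last (c i)) ts)"
  proof -
    have "map h (map (\<lambda>i. last (?c i)) ts) = map (\<lambda>i. last (c i)) ts"
      using ne(1) ts c by (auto simp: last_map[symmetric])
    then show ?thesis by (simp only: rel_of_map[symmetric])
  qed
  ultimately have K: "map_prod h h ` constr k ?c ?b ts = constr k c b ts"
    by (simp add: constr_def image_Un image_UN del: rel_of.simps)
  have inj: "inj_on h (nodes k ?c ?b)"
  proof (rule inj_onI)
    have shape: "(\<exists>i j. z = Chain i j \<and> i \<in> {1..k} \<and> j < length (c i)) \<or>
        (\<exists>i j. z = Link i (Suc j) \<and> i \<in> {1..<k} \<and> j < length (b i))" if "z \<in> nodes k ?c ?b" for z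
    proof -
      consider i where "i \<in> {1..k}" "z \<in> set (?c i)" | i where "i \<in> {1..<k}" "z \<in> set (?b i)"
        using \<open>z \<in> nodes k ?c ?b\<close> unfolding nodes_def by blast
      then show ?thesis
      proof cases
        case 1
        then show ?thesis by (auto simp: std_chain_def)
      next
        case 2
        then obtain j where "z = Link i j" "1 \<le> j" "j \<le> length (b i)"
          by (auto simp: std_link_def)
        then have "z = Link i (Suc (j - 1))" "j - 1 < length (b i)"
          by auto
        then show ?thesis using 2 by blast
      qed
    qed
    fix x y assume "x \<in> nodes k ?c ?b" "y \<in> nodes k ?c ?b" and eq: "h x = h y"
    note shape[OF this(1)] shape[OF this(2)]
    moreover have False if "c i ! j = c i' ! j'" "i \<in> {1..k}" "i' \<in> {1..k}" "j < length (c i)"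
      "j' < length (c i')" "i \<noteq> i'" for i i' j j'
    proof -
      have "set (c i) \<inter> set (c i') = {}"
        using sep that by (simp add: separated_def)
      then show False using that nth_mem[of j "c i"] nth_mem[of j' "c i'"] by auto
    qed
    moreover have False if "b i ! j = b i' ! j'" "i \<in> {1..<k}" "i' \<in> {1..<k}" "j < length (b i)"
      "j' < length (b i')" "i \<noteq> i'" for i i' j j'
    proof -
      have "set (b i) \<inter> set (b i') = {}"
        using sep that by (simp add: separated_def)
      then show False using that nth_mem[of j "b i"] nth_mem[of j' "b i'"] by auto
    qed
    moreover have False if "c i ! j = b i' ! j'" "i \<in> {1..k}" "i' \<in> {1..<k}" "j < length (c i)"
      "j' < length (b i')" for i i' j j'
    proof -
      have "set (c i) \<inter> set (b i') = {}"
        using sep that by (simp add: separated_def)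
      then show False using that nth_mem[of j "c i"] nth_mem[of j' "b i'"] by auto
    qed
    moreover have "j = j'" if "c i ! j = c i ! j'" "i \<in> {1..k}" "j < length (c i)" "j' < length (c i)"
      for i j j'
      using sep that nth_eq_iff_index_eq[of "c i"] by (auto simp: separated_def)
    moreover have "j = j'" if "b i ! j = b i ! j'" "i \<in> {1..<k}" "j < length (b i)" "j' < length (b i)"
      for i j j'
      using sep that nth_eq_iff_index_eq[of "b i"] by (auto simp: separated_def)
    ultimately show "x = y"
      using eq unfolding h_def by (elim disjE exE conjE; simp; metis)
  qed
  have "constr k ?c ?b ts \<subseteq> nodes k ?c ?b \<times> nodes k ?c ?b"
    using constr_subset ne(1) ts by blast
  from card_exts_image[OF inj this] show ?thesis
    by (simp add: N K count_exts_def)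
qed

section \<open>The order \<open>G\<close> as a system of chains and links\<close>

lemma rel_of_map_upt: "rel_of (map g [a..<b]) = {(g i, g j) | i j. a \<le> i \<and> i \<le> j \<and> j < b}"
proof (induction b)
  case (Suc b)
  show ?case
  proof (cases "a \<le> b")
    case True
    have "{(g i, g j) |i j. a \<le> i \<and> i \<le> j \<and> j < Suc b} =
        {(g i, g j) |i j. a \<le> i \<and> i \<le> j \<and> j < b} \<union> {(g i, g b) |i. a \<le> i \<and> i \<le> b}"
      by (auto simp: less_Suc_eq)
    also have "{(g i, g b) |i. a \<le> i \<and> i \<le> b} = insert (g b, g b) (g ` {a..<b} \<times> {g b})"
      using True by (auto simp: le_less)
    finally show ?thesis
      using True Suc by (simp add: rel_of_append)
  qed auto
qed simp

text \<open>Within a chain, within a link and among the tops, \<open>G_gens\<close> supplies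
  neighbouring pairs only; a transitive relation needs no more.\<close>

lemma rel_of_map_upt_subset:
  assumes "trans R" "\<And>j. a \<le> j \<Longrightarrow> j < b \<Longrightarrow> (g j, g j) \<in> R"
    and "\<And>j. a \<le> j \<Longrightarrow> Suc j < b \<Longrightarrow> (g j, g (Suc j)) \<in> R"
  shows "rel_of (map g [a..<b]) \<subseteq> R"
proof -
  have "(g i, g j) \<in> R" if "i \<le> j" "a \<le> i" "j < b" for i j
    using that
  proof (induction j rule: dec_induct)
    case base
    then show ?case using assms(2) by simp
  next
    case (step n)
    then have "(g i, g n) \<in> R" "(g n, g (Suc n)) \<in> R"
      using assms(3) by simp_all
    then show ?case using assms(1) by (meson transD)
  qed
  then show ?thesis by (auto simp: rel_of_map_upt)
qed

text \<open>A linear order on the nodes contains the order generated by \<open>G_gens\<close> iff it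
  contains the constraints of the system: the generators are among the constraints, and the
  constraints follow from the generators by transitivity and reflexivity. The i-th chain has v_i + 1
  elements, hence \<open>Suc\<close>.\<close>

lemma \<L>_G:
  fixes V B :: "nat list"
  assumes k: "length V = k" and \<sigma>: "\<And>i. i \<in> {1..k} \<Longrightarrow> \<sigma> i \<in> {1..k}"
  shows "\<L> (G (V, B) \<sigma>) = count_exts k (map \<sigma> [1..<Suc k]) (\<lambda>i. Suc (V !\<^sub>1 i)) (\<lambda>i. B !\<^sub>1 i)"
proof -
  define c where "c = std_chain (\<lambda>i. Suc (V !\<^sub>1 i))"
  define b where "b = std_link (\<lambda>i. B !\<^sub>1 i)"
  define ts where "ts = map \<sigma> [1..<Suc k]"
  define N where "N = nodes k c b"
  define K where "K = constr k c b ts"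
  have c: "c i = map (Chain i) [0..<Suc (V !\<^sub>1 i)]" for i
    by (simp add: c_def std_chain_def)
  have b: "b i = map (Link i) [1..<Suc (B !\<^sub>1 i)]" for i
    by (simp add: b_def std_link_def)
  have nodes: "G_nodes V B = N"
    unfolding N_def G_nodes_def nodes_def c b k set_map set_upt
    by (intro arg_cong2[of _ _ _ _ "(\<union>)"]) fastforce+
  have hd: "hd (c i) = Chain i 0" for i
    by (simp add: c hd_map del: upt_Suc)
  have last: "last (c i) = Chain i (V !\<^sub>1 i)" for i
    by (simp add: c)
  have tops: "map (\<lambda>i. last (c i)) ts = map (\<lambda>i. Chain (\<sigma> i) (V !\<^sub>1 \<sigma> i)) [1..<Suc k]"
    by (simp only: ts_def map_map comp_def last)
  have "K \<subseteq> N \<times> N"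
  proof (unfold K_def N_def, rule constr_subset)
    have "set ts = \<sigma> ` {1..k}"
      by (simp only: ts_def set_map set_upt atLeastLessThanSuc_atLeastAtMost)
    then show "set ts \<subseteq> {1..k}"
      by (metis \<sigma> image_subsetI)
  qed (simp add: c)
  have gens: "G_gens V B \<sigma> \<subseteq> K"
  proof -
    have "(Chain i j, Chain i (j + 1)) \<in> K" if "i \<in> {1..k}" "j < V !\<^sub>1 i" for i j
      using that unfolding K_def constr_def c rel_of_map_upt by auto
    moreover have "(Chain i 0, Chain (i + 1) 0) \<in> K" if "i \<in> {1..<k}" for i
      using that unfolding K_def constr_def hd by auto
    moreover have "(Link i j, Link i (j + 1)) \<in> K" if "i \<in> {1..<k}" "j \<in> {1..<B !\<^sub>1 i}" for i j
    proof -
      have "(Link i j, Link i (j + 1)) \<in> rel_of (b i)"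
        using that unfolding b rel_of_map_upt by auto
      then show ?thesis using that unfolding K_def constr_def by (auto simp: rel_of_append)
    qed
    moreover have "(Chain i 0, Link i j) \<in> K \<and> (Link i j, Chain (i + 1) 0) \<in> K"
      if "i \<in> {1..<k}" "j \<in> {1..B !\<^sub>1 i}" for i j
    proof -
      have "Link i j \<in> set (b i)"
        using that by (auto simp: b)
      then have "{(Chain i 0, Link i j), (Link i j, Chain (i + 1) 0)} \<subseteq>
          rel_of (hd (c i) # b i @ [hd (c (Suc i))])"
        unfolding hd by (auto simp: rel_of_append)
      then show ?thesis using that unfolding K_def constr_def by blast
    qed
    moreover have "(Chain (\<sigma> i) (V !\<^sub>1 \<sigma> i), Chain (\<sigma> (i + 1)) (V !\<^sub>1 \<sigma> (i + 1))) \<in> K"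
      if "i \<in> {1..<k}" for i
      using that unfolding K_def constr_def tops rel_of_map_upt by force
    ultimately show ?thesis
      unfolding G_gens_def k by blast
  qed
  \<comment> \<open>The generators sorted by kind and written with \<open>Suc\<close>, as an
    introduction rule.\<close>
  have step: "(x, y) \<in> G_gens V B \<sigma>" if
    "(\<exists>i j. x = Chain i j \<and> y = Chain i (Suc j) \<and> i \<in> {1..k} \<and> j < V !\<^sub>1 i) \<or>
     (\<exists>i. x = Chain i 0 \<and> y = Chain (Suc i) 0 \<and> i \<in> {1..<k}) \<or>
     (\<exists>i j. x = Link i j \<and> y = Link i (Suc j) \<and> i \<in> {1..<k} \<and> j \<in> {1..<B !\<^sub>1 i}) \<or>
     (\<exists>i j. x = Chain i 0 \<and> y = Link i j \<and> i \<in> {1..<k} \<and> j \<in> {1..B !\<^sub>1 i}) \<or>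
     (\<exists>i j. x = Link i j \<and> y = Chain (Suc i) 0 \<and> i \<in> {1..<k} \<and> j \<in> {1..B !\<^sub>1 i}) \<or>
     (\<exists>i. x = Chain (\<sigma> i) (V !\<^sub>1 \<sigma> i) \<and> y = Chain (\<sigma> (Suc i)) (V !\<^sub>1 \<sigma> (Suc i)) \<and> i \<in> {1..<k})" for x y
    using that unfolding G_gens_def k Suc_eq_plus1 by blast
  have F: "Field (G (V, B) \<sigma>) = N"
  proof -
    have "(G_gens V B \<sigma>)\<^sup>+ \<subseteq> N \<times> N"
      using gens \<open>K \<subseteq> N \<times> N\<close> by (intro trancl_subset_Sigma) blast
    then show ?thesis
      unfolding G_def Field_def by (auto simp: nodes)
  qed
  have "G (V, B) \<sigma> \<subseteq> R \<longleftrightarrow> K \<subseteq> R" if R: "linear_order_on N R" for R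
  proof
    have tr: "trans R" and refl: "(x, x) \<in> R" if "x \<in> N" for x
      using R that by (auto simp: linear_order_on_iff)
    have refl': "(Chain i j, Chain i j) \<in> R" if "i \<in> {1..k}" "j \<le> V !\<^sub>1 i" for i j
      by (rule refl) (use that nodes in \<open>auto simp: G_nodes_def k\<close>)
    {
      assume "K \<subseteq> R"
      then have "(G_gens V B \<sigma>)\<^sup>+ \<subseteq> R\<^sup>+"
        using gens by (intro trancl_mono_subset) blast
      moreover have "R\<^sup>+ = R"
        using R by (simp add: linear_order_on_iff trancl_id)
      ultimately show "G (V, B) \<sigma> \<subseteq> R"
        using refl by (auto simp: G_def nodes)
    }
    assume "G (V, B) \<sigma> \<subseteq> R"
    then have g: "(x, y) \<in> R" if "(x, y) \<in> G_gens V B \<sigma>" for x y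
      using that by (auto simp: G_def)
    have tr: "trans R"
      using R by (simp add: linear_order_on_iff)
    have "rel_of (c i) \<subseteq> R" if "i \<in> {1..k}" for i
      unfolding c
    proof (rule rel_of_map_upt_subset[OF tr])
      fix j assume "j < Suc (V !\<^sub>1 i)"
      then show "(Chain i j, Chain i j) \<in> R"
        using that by (intro refl') auto
    next
      fix j assume "Suc j < Suc (V !\<^sub>1 i)"
      then show "(Chain i j, Chain i (Suc j)) \<in> R"
        using that by (intro g step) simp
    qed
    moreover have "rel_of (hd (c i) # b i @ [hd (c (Suc i))]) \<subseteq> R" if "i \<in> {1..<k}" for i
    proof -
      have "rel_of (b i) \<subseteq> R"
        unfolding b
      proof (rule rel_of_map_upt_subset[OF tr])
        fix j assume "1 \<le> j" "j < Suc (B !\<^sub>1 i)"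
        then show "(Link i j, Link i j) \<in> R"
          by (intro refl) (use that nodes in \<open>auto simp: G_nodes_def k\<close>)
      next
        fix j assume "1 \<le> j" "Suc j < Suc (B !\<^sub>1 i)"
        then show "(Link i j, Link i (Suc j)) \<in> R"
          using that by (intro g step) simp
      qed
      moreover have "{hd (c i)} \<times> set (b i) \<subseteq> R" "set (b i) \<times> {hd (c (Suc i))} \<subseteq> R"
      proof -
        have "(Chain i 0, Link i j) \<in> R" "(Link i j, Chain (Suc i) 0) \<in> R"
          if "1 \<le> j" "j \<le> B !\<^sub>1 i" for j
          using that \<open>i \<in> {1..<k}\<close> by (intro g step; simp)+
        then show "{hd (c i)} \<times> set (b i) \<subseteq> R" "set (b i) \<times> {hd (c (Suc i))} \<subseteq> R"
          unfolding hd by (auto simp: b simp del: upt_Suc)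
      qed
      moreover have "(hd (c i), hd (c i)) \<in> R" "(hd (c i), hd (c (Suc i))) \<in> R"
        "(hd (c (Suc i)), hd (c (Suc i))) \<in> R"
      proof -
        show "(hd (c i), hd (c (Suc i))) \<in> R"
          unfolding hd using that by (intro g step) simp
      qed (use that in \<open>simp_all add: hd refl'\<close>)
      ultimately show ?thesis
        by (simp add: rel_of_append)
    qed
    moreover have "rel_of (map (\<lambda>i. last (c i)) ts) \<subseteq> R"
      unfolding tops
    proof (rule rel_of_map_upt_subset[OF tr])
      fix j assume "1 \<le> j" "j < Suc k"
      then show "(Chain (\<sigma> j) (V !\<^sub>1 \<sigma> j), Chain (\<sigma> j) (V !\<^sub>1 \<sigma> j)) \<in> R"
        using \<sigma>[of j] by (intro refl') auto
    next
      fix j assume "1 \<le> j" "Suc j < Suc k"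
      then show "(Chain (\<sigma> j) (V !\<^sub>1 \<sigma> j), Chain (\<sigma> (Suc j)) (V !\<^sub>1 \<sigma> (Suc j))) \<in> R"
        by (intro g step disjI2 exI[of _ j]) simp
    qed
    ultimately show "K \<subseteq> R"
      unfolding K_def constr_def by blast
  qed
  then have "linear_extensions (G (V, B) \<sigma>) = exts N K"
    unfolding linear_extensions_def exts_def F by blast
  then show ?thesis
    by (simp only: \<L>_def count_exts_def N_def K_def c_def b_def ts_def)
qed

section \<open>Merging a pendant chain\<close>

text \<open>In a linear order the elements of the chain \<open>P\<close> below \<open>h\<close> form
  an initial segment of \<open>P\<close>; its length \<open>m\<close> classifies the
  extensions.\<close>

lemma card_exts_split:
  assumes fin: "finite S" and h: "h \<in> S - set P" and P: "set P \<subseteq> S" "distinct P" "rel_of P \<subseteq> K"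
  shows "card (exts S K) =
    (\<Sum>m\<le>length P. card (exts S (K \<union> set (take m P) \<times> {h} \<union> {h} \<times> set (drop m P))))"
proof -
  let ?K = "\<lambda>m. set (take m P) \<times> {h} \<union> {h} \<times> set (drop m P)"
  \<comment> \<open>If \<open>h\<close> is below the first entry, the cut is 0; otherwise the cut of
    the tail moves up by one.\<close>
  have ex: "\<exists>m\<le>length Q. set (take m Q) \<times> {h} \<union> {h} \<times> set (drop m Q) \<subseteq> R"
    if "linear_order_on S R" "set Q \<subseteq> S" "rel_of Q \<subseteq> R" "h \<in> S" for R Q
    using that(2,3)
  proof (induction Q)
    case (Cons x xs)
    have tr: "trans R"
      using that by (simp add: linear_order_on_iff)
    have "(h, x) \<in> R \<or> (x, h) \<in> R"
      using that Cons.prems by (simp add: linear_order_on_iff)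
    then show ?case
    proof
      assume "(h, x) \<in> R"
      moreover have "(x, y) \<in> R" if "y \<in> set (x # xs)" for y
        using Cons.prems that by auto
      ultimately have "{h} \<times> set (x # xs) \<subseteq> R"
        using tr by (blast dest: transD)
      then show ?thesis
        by (intro exI[of _ 0]) simp
    next
      assume "(x, h) \<in> R"
      moreover obtain m where "m \<le> length xs" "set (take m xs) \<times> {h} \<union> {h} \<times> set (drop m xs) \<subseteq> R"
        using Cons by auto
      ultimately show ?thesis
        by (intro exI[of _ "Suc m"]) simp
    qed
  qed simp
  \<comment> \<open>Of two cuts \<open>m < m'\<close>, the first puts the entry \<open>P ! m\<close>
    above \<open>h\<close> and the second puts it below.\<close>
  have uniq: False if "linear_order_on S R" "?K m \<subseteq> R" "?K m' \<subseteq> R" "m < m'" "m' \<le> length P" for R m m'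
  proof -
    have "P ! m \<in> set (drop m P)" "P ! m \<in> set (take m' P)"
      using that(4,5) by (auto simp: in_set_conv_nth intro: exI[of _ 0] exI[of _ m])
    then have "(h, P ! m) \<in> R" "(P ! m, h) \<in> R"
      using that(2,3) by auto
    then have "h = P ! m"
      using that(1) by (auto simp: linear_order_on_iff dest: antisymD)
    then show False
      using h that(4,5) by auto
  qed
  have "exts S K = (\<Union>m\<le>length P. exts S (K \<union> ?K m))"
  proof (intro equalityI subsetI)
    fix R assume "R \<in> exts S K"
    then have R: "linear_order_on S R" "K \<subseteq> R"
      by (auto simp: exts_def)
    then obtain m where "m \<le> length P" "?K m \<subseteq> R"
      using ex[OF R(1) P(1)] h P(3) by blast
    then show "R \<in> (\<Union>m\<le>length P. exts S (K \<union> ?K m))"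
      using R by (auto simp: exts_def)
  qed (auto simp: exts_def)
  moreover have "exts S (K \<union> ?K m) \<inter> exts S (K \<union> ?K m') = {}"
    if "m \<le> length P" "m' \<le> length P" "m \<noteq> m'" for m m'
  proof (rule ccontr)
    assume "exts S (K \<union> ?K m) \<inter> exts S (K \<union> ?K m') \<noteq> {}"
    then obtain R where R: "linear_order_on S R" "?K m \<subseteq> R" "?K m' \<subseteq> R"
      unfolding exts_def by auto
    show False
      using uniq[OF R] uniq[OF R(1,3,2)] that by (meson linorder_neqE_nat)
  qed
  ultimately show ?thesis
    using finite_exts[OF fin] by (simp add: card_UN_disjoint Un_assoc)
qed

section \<open>Cutting the pendant chain at one gap\<close>

lemma linear_order_on_refl: "linear_order_on S R \<Longrightarrow> x \<in> S \<Longrightarrow> (x, x) \<in> R"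
  by (auto simp: linear_order_on_iff)

lemma constr_subset_iff:
  "constr k c b ts \<subseteq> R \<longleftrightarrow> (\<forall>i\<in>{1..k}. rel_of (c i) \<subseteq> R) \<and>
    (\<forall>i\<in>{1..<k}. rel_of (hd (c i) # b i @ [hd (c (Suc i))]) \<subseteq> R) \<and>
    rel_of (map (\<lambda>i. last (c i)) ts) \<subseteq> R"
  by (simp only: constr_def Un_subset_iff UN_subset_iff conj_assoc)

lemma hd_le_hd:
  assumes "trans R" "constr k c b ts \<subseteq> R" "c i \<noteq> []" "1 \<le> i" "i \<le> i'" "i' \<le> k"
  shows "(hd (c i), hd (c i')) \<in> R"
  using assms(5,6)
proof (induction i' rule: dec_induct)
  case base
  then have "rel_of (c i) \<subseteq> R"
    using assms unfolding constr_subset_iff by simp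
  then show ?case
    using assms(3) refl_rel_of[of "hd (c i)" "c i"] by auto
next
  case (step j)
  then have "rel_of (hd (c j) # b j @ [hd (c (Suc j))]) \<subseteq> R"
    using assms unfolding constr_subset_iff by simp
  then have "(hd (c j), hd (c (Suc j))) \<in> R"
    by auto
  then show ?case
    using step assms(1) by (meson Suc_leD transD)
qed

lemma hd_le:
  assumes "trans R" "constr k c b ts \<subseteq> R" "i \<in> {1..k}" "x \<in> set (c i)"
  shows "(hd (c i), x) \<in> R"
proof -
  have "rel_of (c i) \<subseteq> R"
    using assms unfolding constr_subset_iff by blast
  then show ?thesis
    using assms(4) by (cases "c i") auto
qed

text \<open>The elements of \<open>L\<close> and \<open>T\<close> form an autonomous subset once \<open>h\<close> separates \<open>T\<close> from \<open>U\<close>.\<close>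

lemma rel_of_gap_iff:
  assumes tr: "trans R" and refl: "(g, g) \<in> R" "(h, h) \<in> R" "(z, z) \<in> R"
  shows "insert (h, z) (rel_of (g # L @ [h]) \<union> rel_of (g # (T @ U) @ [z]) \<union>
      set T \<times> {h} \<union> {h} \<times> set U) \<subseteq> R \<longleftrightarrow>
    insert (g, h) (rel_of (h # U @ [z])) \<union> {g} \<times> (set L \<union> set T) \<union> (set L \<union> set T) \<times> {h} \<union>
      (rel_of L \<union> rel_of T) \<subseteq> R" (is "?l \<longleftrightarrow> ?r")
proof
  assume ?l
  then have l: "(g, h) \<in> R" "\<And>x. x \<in> set T \<Longrightarrow> (g, x) \<in> R \<and> (x, h) \<in> R"
    "\<And>x. x \<in> set L \<Longrightarrow> (g, x) \<in> R \<and> (x, h) \<in> R" "(h, z) \<in> R"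
    "\<And>x. x \<in> set U \<Longrightarrow> (h, x) \<in> R \<and> (x, z) \<in> R"
    "rel_of L \<subseteq> R" "rel_of T \<subseteq> R" "rel_of U \<subseteq> R"
    by (auto simp: rel_of_append)
  then show ?r
    using refl by (auto simp: rel_of_append)
next
  assume r: ?r
  then have r': "(g, h) \<in> R" "\<And>x. x \<in> set T \<Longrightarrow> (g, x) \<in> R \<and> (x, h) \<in> R"
    "\<And>x. x \<in> set L \<Longrightarrow> (g, x) \<in> R \<and> (x, h) \<in> R" "(h, z) \<in> R"
    "\<And>x. x \<in> set U \<Longrightarrow> (h, x) \<in> R \<and> (x, z) \<in> R"
    "rel_of L \<subseteq> R" "rel_of T \<subseteq> R" "rel_of U \<subseteq> R"
    by (auto simp: rel_of_append)
  \<comment> \<open>All pairs still missing lead across the separating element \<open>h\<close>, to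
    \<open>U\<close> or to \<open>z\<close>.\<close>
  have below: "(x, z) \<in> R" "\<And>y. y \<in> set U \<Longrightarrow> (x, y) \<in> R" if "(x, h) \<in> R" for x
    using r'(4,5) transD[OF tr that] by blast+
  have "(g, z) \<in> R" "\<And>x. x \<in> set U \<Longrightarrow> (g, x) \<in> R"
    using below[OF r'(1)] by blast+
  moreover have "\<And>x y. x \<in> set T \<Longrightarrow> y \<in> set U \<Longrightarrow> (x, y) \<in> R"
    "\<And>x. x \<in> set T \<Longrightarrow> (x, z) \<in> R"
    using below r'(2) by blast+
  ultimately show ?l
    using r' refl by (auto simp: rel_of_append)
qed

lemma rel_of_subset_Times: "set xs \<subseteq> X \<Longrightarrow> rel_of xs \<subseteq> X \<times> X"
  using rel_of_subset[of xs] by blast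

text \<open>\<open>P\<close> lies above the least element \<open>g\<close> of the chain
  \<open>j\<close> and below the top \<open>z\<close> of the chain \<open>l\<close>. It is cut at
  \<open>h\<close>, the least element of the chain \<open>j + 1\<close>. The \<open>m\<close>
  entries of \<open>P\<close> below \<open>h\<close> and the link \<open>j\<close> are then two
  disjoint chains with the same outer relations: above \<open>g\<close> and below \<open>h\<close>.
  Their arrangements are counted by the binomial coefficient, and their concatenation becomes the
  new link \<open>j\<close>. The rest of \<open>P\<close> starts at \<open>h\<close>, so the same
  situation recurs with \<open>j + 1\<close>.\<close>

lemma card_exts_step:
  assumes sep: "separated k c b" and ts: "set ts \<subseteq> {1..k}"
    and j: "1 \<le> j" "j < l" "l \<le> k" and P: "distinct P" "set P \<inter> nodes k c b = {}"
  shows "card (exts (nodes k c b \<union> set P) (constr k c b ts \<union> rel_of (hd (c j) # P @ [last (c l)]))) =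
    (\<Sum>m\<le>length P. ((length (b j) + m) choose m) *
      card (exts (nodes k c (b(j := b j @ take m P)) \<union> set (drop m P))
        (constr k c (b(j := b j @ take m P)) ts \<union>
          rel_of (hd (c (Suc j)) # drop m P @ [last (c l)]))))"
proof -
  define S where "S = nodes k c b \<union> set P"
  define g where "g = hd (c j)"
  define h where "h = hd (c (Suc j))"
  define z where "z = last (c l)"
  have c: "c i \<noteq> []" "set (c i) \<subseteq> nodes k c b" "set (c i) \<inter> set (b j) = {}" if "i \<in> {1..k}" for i
    using that sep j unfolding separated_def by (auto intro: nodesI)
  have b: "set (b i) \<subseteq> nodes k c b" "i \<noteq> j \<Longrightarrow> set (b i) \<inter> set (b j) = {}" if "i \<in> {1..<k}" for i
    using that sep j unfolding separated_def by (auto intro: nodesI)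
  have ghz: "g \<in> set (c j)" "h \<in> set (c (Suc j))" "z \<in> set (c l)"
    using j by (auto simp: g_def h_def z_def c)
  have ghzS: "g \<in> S" "h \<in> S" "z \<in> S"
    using ghz c(2)[of j] c(2)[of "Suc j"] c(2)[of l] j by (auto simp: S_def)
  have finS: "finite S"
    by (simp add: S_def finite_nodes)
  have hS: "h \<in> S - set P"
    using ghz(2) c(2)[of "Suc j"] P(2) j unfolding S_def by auto
  have "rel_of P \<subseteq> rel_of (g # P @ [z])"
    by (auto simp: rel_of_append)
  then have "rel_of P \<subseteq> constr k c b ts \<union> rel_of (g # P @ [z])"
    by blast
  from card_exts_split[OF finS hS _ P(1) this]
  have "card (exts S (constr k c b ts \<union> rel_of (g # P @ [z]))) =
    (\<Sum>m\<le>length P. card (exts S (constr k c b ts \<union> rel_of (g # P @ [z]) \<union>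
      set (take m P) \<times> {h} \<union> {h} \<times> set (drop m P))))"
    by (simp add: S_def)
  also have "\<dots> = (\<Sum>m\<le>length P. ((length (b j) + m) choose m) *
      card (exts (nodes k c (b(j := b j @ take m P)) \<union> set (drop m P))
        (constr k c (b(j := b j @ take m P)) ts \<union> rel_of (h # drop m P @ [z]))))"
  proof (rule sum.cong[OF refl])
    fix m assume "m \<in> {..length P}"
    define T U where "T = take m P" and "U = drop m P"
    define b' where "b' = b(j := b j @ T)"
    define D where "D = set (b j) \<union> set T"
    \<comment> \<open>The constraints that avoid \<open>D\<close>: of the gap \<open>j\<close> only
      \<open>g\<close> below \<open>h\<close> is kept, and of \<open>P\<close> only the part
      \<open>U\<close> between \<open>h\<close> and \<open>z\<close>.\<close>
    define Q where "Q = (\<Union>i\<in>{1..k}. rel_of (c i)) \<union>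
      (\<Union>i\<in>{1..<k} - {j}. rel_of (hd (c i) # b i @ [hd (c (Suc i))])) \<union>
      rel_of (map (\<lambda>i. last (c i)) ts) \<union> insert (g, h) (rel_of (h # U @ [z]))"
    have PTU: "P = T @ U" and lenT: "length T = m"
      using \<open>m \<in> _\<close> by (auto simp: T_def U_def)
    have jk: "j \<in> {1..<k}"
      using j by auto
    have split: "(\<forall>i\<in>{1..<k}. A i) \<longleftrightarrow> A j \<and> (\<forall>i\<in>{1..<k} - {j}. A i)" for A :: "nat \<Rightarrow> bool"
      using jk by blast
    have refl: "(g, g) \<in> R" "(h, h) \<in> R" "(z, z) \<in> R" if "linear_order_on S R" for R
      using that ghzS by (auto intro: linear_order_on_refl)
    have "exts S (constr k c b ts \<union> rel_of (g # P @ [z]) \<union> set T \<times> {h} \<union> {h} \<times> set U) =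
        exts S (Q \<union> {g} \<times> D \<union> D \<times> {h} \<union> (rel_of (b j) \<union> rel_of T))"
    proof (rule exts_cong)
      fix R assume R: "linear_order_on S R"
      then have tr: "trans R"
        by (simp add: linear_order_on_iff)
      \<comment> \<open>The side with the separated gap asks for \<open>h\<close> below
        \<open>z\<close>, even if \<open>U\<close> is empty. Before the separation this comes from
        the increasing least elements up to the chain \<open>l\<close> and from that chain
        itself.\<close>
      have "(h, z) \<in> R" if "constr k c b ts \<subseteq> R"
      proof -
        have "(h, hd (c l)) \<in> R"
          unfolding h_def by (rule hd_le_hd[OF tr that]) (use j c in auto)
        moreover have "(hd (c l), z) \<in> R"
          by (rule hd_le[OF tr that _ ghz(3)]) (use j in auto)
        ultimately show ?thesis
          using tr by (meson transD)
      qed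
      then have "constr k c b ts \<union> rel_of (g # P @ [z]) \<union> set T \<times> {h} \<union> {h} \<times> set U \<subseteq> R \<longleftrightarrow>
          constr k c b ts \<subseteq> R \<and> insert (h, z) (rel_of (g # b j @ [h]) \<union> rel_of (g # (T @ U) @ [z]) \<union>
            set T \<times> {h} \<union> {h} \<times> set U) \<subseteq> R"
      proof -
        have "rel_of (g # b j @ [h]) \<subseteq> R" if "constr k c b ts \<subseteq> R"
          using that jk unfolding constr_subset_iff g_def h_def by fast
        with \<open>constr k c b ts \<subseteq> R \<Longrightarrow> (h, z) \<in> R\<close> show ?thesis
          unfolding PTU Un_subset_iff insert_subset by argo
      qed
      also have "\<dots> \<longleftrightarrow> constr k c b ts \<subseteq> R \<and> insert (g, h) (rel_of (h # U @ [z])) \<union>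
          {g} \<times> D \<union> D \<times> {h} \<union> (rel_of (b j) \<union> rel_of T) \<subseteq> R"
        by (simp only: rel_of_gap_iff[OF tr refl[OF R]] D_def)
      also have "\<dots> \<longleftrightarrow> Q \<union> {g} \<times> D \<union> D \<times> {h} \<union> (rel_of (b j) \<union> rel_of T) \<subseteq> R"
      proof -
        have "rel_of (g # b j @ [h]) \<subseteq> R" if "(g, h) \<in> R" "{g} \<times> D \<union> D \<times> {h} \<union> rel_of (b j) \<subseteq> R"
          using that refl[OF R] by (auto simp: rel_of_append D_def)
        then show ?thesis
          unfolding Q_def constr_subset_iff split Un_subset_iff UN_subset_iff insert_subset
            g_def[symmetric] h_def[symmetric] by argo
      qed
      finally show "constr k c b ts \<union> rel_of (g # P @ [z]) \<union> set T \<times> {h} \<union> {h} \<times> set U \<subseteq> R \<longleftrightarrow>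
        Q \<union> {g} \<times> D \<union> D \<times> {h} \<union> (rel_of (b j) \<union> rel_of T) \<subseteq> R" .
    qed
    moreover have "card (exts S (Q \<union> {g} \<times> D \<union> D \<times> {h} \<union> (rel_of (b j) \<union> rel_of T))) =
        card (exts D (rel_of (b j) \<union> rel_of T)) *
        card (exts S (Q \<union> {g} \<times> D \<union> D \<times> {h} \<union> rel_of (b j @ T)))"
    proof (rule card_exts_autonomous[OF finS])
      have cD: "set (c i) \<subseteq> S - D" if "i \<in> {1..k}" for i
        using c[OF that] P(2) PTU unfolding S_def D_def by auto
      have bD: "set (b i) \<subseteq> S - D" if "i \<in> {1..<k} - {j}" for i
        using b[of i] that P(2) PTU unfolding S_def D_def by auto
      have hdD: "hd (c i) \<in> S - D" "last (c i) \<in> S - D" if "i \<in> {1..k}" for i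
        using subsetD[OF cD[OF that]] hd_in_set[OF c(1)[OF that]] last_in_set[OF c(1)[OF that]]
        by blast+
      have ghz': "g \<in> S - D" "h \<in> S - D" "z \<in> S - D"
        using hdD j by (auto simp: g_def h_def z_def)
      have "set U \<subseteq> S - D"
        using P b(1)[OF jk] unfolding S_def D_def PTU by auto
      then have "rel_of (h # U @ [z]) \<subseteq> (S - D) \<times> (S - D)"
        by (intro rel_of_subset_Times) (use ghz' in auto)
      moreover have "rel_of (map (\<lambda>i. last (c i)) ts) \<subseteq> (S - D) \<times> (S - D)"
        by (intro rel_of_subset_Times) (use hdD ts in auto)
      moreover have "rel_of (c i) \<subseteq> (S - D) \<times> (S - D)" if "i \<in> {1..k}" for i
        by (intro rel_of_subset_Times cD that)
      moreover have "rel_of (hd (c i) # b i @ [hd (c (Suc i))]) \<subseteq> (S - D) \<times> (S - D)"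
        if "i \<in> {1..<k} - {j}" for i
        by (intro rel_of_subset_Times) (use that bD hdD in auto)
      ultimately show "Q \<subseteq> (S - D) \<times> (S - D)"
        using ghz' unfolding Q_def by blast
      show "{g} \<subseteq> S - D" "{h} \<subseteq> S - D"
        using ghz' by auto
      show "D \<subseteq> S"
        using b(1)[OF jk] unfolding S_def D_def PTU by auto
      show "rel_of (b j) \<union> rel_of T \<subseteq> D \<times> D"
        using rel_of_subset[of "b j"] rel_of_subset[of T] unfolding D_def by blast
      show "set (b j @ T) = D"
        by (simp add: D_def)
      show dist: "distinct (b j @ T)"
        using sep jk P b(1)[OF jk] unfolding PTU separated_def by auto
    qed
    moreover have "card (exts D (rel_of (b j) \<union> rel_of T)) = (length (b j) + m) choose m"
    proof -
      \<comment> \<open>\<open>T\<close> stands first because \<open>card_exts_two_chains\<close>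
        chooses the positions of its first list; this gives \<open>choose m\<close>.\<close>
      have "distinct (T @ b j)"
        using sep jk P b(1)[OF jk] unfolding PTU separated_def by auto
      from card_exts_two_chains[OF this, of D] show ?thesis
        by (simp add: D_def lenT Un_commute add.commute)
    qed
    moreover have "exts S (Q \<union> {g} \<times> D \<union> D \<times> {h} \<union> rel_of (b j @ T)) =
        exts (nodes k c b' \<union> set U) (constr k c b' ts \<union> rel_of (h # U @ [z]))"
    proof -
      have "nodes k c b' = nodes k c b \<union> set T"
        using jk unfolding nodes_def b'_def by (auto split: if_splits)
      then have "nodes k c b' \<union> set U = S"
        by (auto simp: S_def PTU)
      moreover have "exts S (Q \<union> {g} \<times> D \<union> D \<times> {h} \<union> rel_of (b j @ T)) =
          exts S (constr k c b' ts \<union> rel_of (h # U @ [z]))"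
      proof (rule exts_cong)
        fix R assume R: "linear_order_on S R"
        have "rel_of (g # (b j @ T) @ [h]) = {(g, g), (g, h), (h, h)} \<union> {g} \<times> D \<union> D \<times> {h} \<union> rel_of (b j @ T)"
          by (auto simp: rel_of_append D_def)
        then have "rel_of (g # (b j @ T) @ [h]) \<subseteq> R \<longleftrightarrow>
            insert (g, h) ({g} \<times> D \<union> D \<times> {h} \<union> rel_of (b j @ T)) \<subseteq> R"
          using refl[OF R] by simp
        moreover have "b' j = b j @ T" "\<And>i. i \<in> {1..<k} - {j} \<Longrightarrow> b' i = b i"
          by (auto simp: b'_def)
        ultimately show "Q \<union> {g} \<times> D \<union> D \<times> {h} \<union> rel_of (b j @ T) \<subseteq> R \<longleftrightarrow>
            constr k c b' ts \<union> rel_of (h # U @ [z]) \<subseteq> R"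
          unfolding Q_def Un_subset_iff UN_subset_iff insert_subset constr_subset_iff split
            g_def[symmetric] h_def[symmetric] by (auto simp del: rel_of.simps)
      qed
      ultimately show ?thesis by simp
    qed
    ultimately show "card (exts S (constr k c b ts \<union> rel_of (g # P @ [z]) \<union>
        set (take m P) \<times> {h} \<union> {h} \<times> set (drop m P))) = ((length (b j) + m) choose m) *
      card (exts (nodes k c (b(j := b j @ take m P)) \<union> set (drop m P))
        (constr k c (b(j := b j @ take m P)) ts \<union> rel_of (h # drop m P @ [z])))"
      by (simp only: T_def U_def b'_def)
  qed
  finally show ?thesis
    by (simp only: S_def g_def h_def z_def)
qed

text \<open>Now \<open>P\<close> lies between the least and the greatest element of the chain
  \<open>l\<close>, alongside the \<open>length (c l) - 2\<close> inner elements of that chain. Both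
  are chains with the same outer relations, so merging them costs a binomial coefficient. A chain
  with a single element has inner number -1: a nonempty \<open>P\<close> would have to fit between
  an element and itself, which leaves no extension, while an empty \<open>P\<close> changes nothing.
  The convention in \<open>binom\<close> yields exactly these values.\<close>

lemma card_exts_final:
  assumes sep: "separated k c b" and ts: "set ts \<subseteq> {1..k}"
    and l: "l \<in> {1..k}" and P: "distinct P" "set P \<inter> nodes k c b = {}"
  shows "card (exts (nodes k c b \<union> set P) (constr k c b ts \<union> rel_of (hd (c l) # P @ [last (c l)]))) =
    count_exts k ts (\<lambda>i. length (c i) + (if i = l then length P else 0)) (\<lambda>i. length (b i)) *
    binom (int (length (c l)) - 2 + int (length P)) (length P)"
proof -
  define S where "S = nodes k c b \<union> set P"
  have c: "c i \<noteq> []" "set (c i) \<subseteq> nodes k c b" "distinct (c i)" if "i \<in> {1..k}" for i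
    using that sep unfolding separated_def by (auto intro: nodesI)
  have finS: "finite S"
    by (simp add: S_def finite_nodes)
  obtain h Y' where cl: "c l = h # Y'"
    using c(1)[OF l] by (cases "c l") auto
  have hS: "h \<in> S" "h \<notin> set P"
    using c(2)[OF l] P cl by (auto simp: S_def)
  show ?thesis
  proof (cases Y' rule: rev_cases)
    case Nil
    have K: "constr k c b ts \<union> rel_of (hd (c l) # P @ [last (c l)]) =
        constr k c b ts \<union> rel_of (h # P @ [h])"
      using cl Nil by simp
    show ?thesis
    proof (cases "P = []")
      case True
      have "exts S (constr k c b ts \<union> rel_of (h # P @ [h])) = exts S (constr k c b ts)"
        by (rule exts_cong) (use True hS in \<open>auto dest: linear_order_on_refl\<close>)
      then show ?thesis
        unfolding K using card_exts_system[OF sep ts] True cl Nil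
        by (simp add: S_def binom_def if_distrib cong: if_cong)
    next
      case False
      then obtain p P' where p: "P = p # P'"
        by (cases P) auto
      \<comment> \<open>\<open>h\<close> and \<open>p\<close> would lie below each other. On the
        other side the coefficient vanishes, its upper entry \<open>length P - 1\<close> being
        smaller than the lower one.\<close>
      have "exts S (constr k c b ts \<union> rel_of (h # P @ [h])) = {}"
      proof -
        have "(h, p) \<in> rel_of (h # P @ [h])" "(p, h) \<in> rel_of (h # P @ [h])" "h \<noteq> p"
          using p hS by auto
        then show ?thesis
          unfolding exts_def linear_order_on_iff antisym_def by blast
      qed
      then show ?thesis
        unfolding K using p cl Nil by (simp add: S_def binom_def)
    qed
  next
    case (snoc Y z)
    define D where "D = set P \<union> set Y"
    \<comment> \<open>Least and greatest element stay, so links and tops are unaffected. The order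
      of \<open>P\<close> and \<open>Y\<close> is a matter of choice, since only the new length
      survives in \<open>count_exts\<close>.\<close>
    define c' where "c' = c(l := h # (P @ Y) @ [z])"
    define Q where "Q = insert (h, z) ((\<Union>i\<in>{1..k} - {l}. rel_of (c i)) \<union>
      (\<Union>i\<in>{1..<k}. rel_of (hd (c i) # b i @ [hd (c (Suc i))])) \<union>
      rel_of (map (\<lambda>i. last (c i)) ts))"
    have cl: "c l = h # Y @ [z]" and c'l: "c' l = h # (P @ Y) @ [z]"
      and c'i: "\<And>i. i \<noteq> l \<Longrightarrow> c' i = c i"
      using cl snoc by (auto simp: c'_def)
    have hz: "h \<in> S - D" "z \<in> S - D" "distinct (P @ Y)" "set Y \<subseteq> nodes k c b"
      using c[OF l] P cl by (auto simp: S_def D_def)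
    have refl: "(h, h) \<in> R" "(z, z) \<in> R" if "linear_order_on S R" for R
      using that hz by (auto intro: linear_order_on_refl)
    have disj: "set (c i) \<inter> set (c l) = {}" if "i \<in> {1..k} - {l}" for i
      using that l sep by (auto simp: separated_def)
    have cD: "set (c i) \<subseteq> S - D" if "i \<in> {1..k} - {l}" for i
      using disj[OF that] c(2)[of i] that P(2) unfolding cl S_def D_def by auto
    have hdD: "hd (c i) \<in> S - D" "last (c i) \<in> S - D" if "i \<in> {1..k}" for i
    proof -
      have "hd (c i) \<in> S - D \<and> last (c i) \<in> S - D"
      proof (cases "i = l")
        case True
        then show ?thesis using hz cl by simp
      next
        case False
        then show ?thesis
          using subsetD[OF cD[of i]] hd_in_set[OF c(1)[OF that]] last_in_set[OF c(1)[OF that]] that by blast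
      qed
      then show "hd (c i) \<in> S - D" "last (c i) \<in> S - D" by blast+
    qed
    have split: "(\<forall>i\<in>{1..k}. A i) \<longleftrightarrow> A l \<and> (\<forall>i\<in>{1..k} - {l}. A i)" for A :: "nat \<Rightarrow> bool"
      using l by blast
    have "exts S (constr k c b ts \<union> rel_of (h # P @ [z])) =
        exts S (Q \<union> {h} \<times> D \<union> D \<times> {z} \<union> (rel_of P \<union> rel_of Y))"
    proof (rule exts_cong)
      fix R assume R: "linear_order_on S R"
      have "rel_of (h # Y @ [z]) \<union> rel_of (h # P @ [z]) =
          {(h, h), (h, z), (z, z)} \<union> {h} \<times> D \<union> D \<times> {z} \<union> (rel_of P \<union> rel_of Y)"
        by (auto simp: rel_of_append D_def)
      then have "rel_of (h # Y @ [z]) \<union> rel_of (h # P @ [z]) \<subseteq> R \<longleftrightarrow>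
          (h, z) \<in> R \<and> {h} \<times> D \<union> D \<times> {z} \<union> (rel_of P \<union> rel_of Y) \<subseteq> R"
        using refl[OF R] by simp
      then show "constr k c b ts \<union> rel_of (h # P @ [z]) \<subseteq> R \<longleftrightarrow>
          Q \<union> {h} \<times> D \<union> D \<times> {z} \<union> (rel_of P \<union> rel_of Y) \<subseteq> R"
        unfolding Q_def constr_subset_iff split cl Un_subset_iff UN_subset_iff insert_subset by argo
    qed
    moreover have "card (exts S (Q \<union> {h} \<times> D \<union> D \<times> {z} \<union> (rel_of P \<union> rel_of Y))) =
        card (exts D (rel_of P \<union> rel_of Y)) * card (exts S (Q \<union> {h} \<times> D \<union> D \<times> {z} \<union> rel_of (P @ Y)))"
    proof (rule card_exts_autonomous[OF finS])
      have "rel_of (map (\<lambda>i. last (c i)) ts) \<subseteq> (S - D) \<times> (S - D)"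
        by (intro rel_of_subset_Times) (use hdD ts in auto)
      moreover have "rel_of (c i) \<subseteq> (S - D) \<times> (S - D)" if "i \<in> {1..k} - {l}" for i
        by (intro rel_of_subset_Times cD that)
      moreover have "rel_of (hd (c i) # b i @ [hd (c (Suc i))]) \<subseteq> (S - D) \<times> (S - D)"
        if "i \<in> {1..<k}" for i
      proof (rule rel_of_subset_Times)
        have "set (b i) \<inter> set (c l) = {}" "set (b i) \<subseteq> nodes k c b"
          using separatedD(7)[OF sep l that] nodesI(2)[OF that] by auto
        then have "set (b i) \<subseteq> S - D"
          using P(2) unfolding cl S_def D_def by auto
        moreover have "i \<in> {1..k}" "Suc i \<in> {1..k}"
          using that by auto
        ultimately show "set (hd (c i) # b i @ [hd (c (Suc i))]) \<subseteq> S - D"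
          using hdD by simp
      qed
      ultimately show "Q \<subseteq> (S - D) \<times> (S - D)"
        using hz unfolding Q_def by blast
      show "{h} \<subseteq> S - D" "{z} \<subseteq> S - D" "D \<subseteq> S"
        using hz by (auto simp: D_def S_def)
      show "rel_of P \<union> rel_of Y \<subseteq> D \<times> D"
        using rel_of_subset[of P] rel_of_subset[of Y] unfolding D_def by blast
      show "set (P @ Y) = D" "distinct (P @ Y)"
        using hz by (simp_all add: D_def)
    qed
    moreover have "card (exts D (rel_of P \<union> rel_of Y)) = (length P + length Y) choose length P"
      using card_exts_two_chains[OF hz(3), of D] by (simp add: D_def)
    moreover have "exts S (Q \<union> {h} \<times> D \<union> D \<times> {z} \<union> rel_of (P @ Y)) =
        exts (nodes k c' b) (constr k c' b ts)"
    proof -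
      have "nodes k c' b = nodes k c b \<union> set (c' l)"
      proof -
        have "(\<Union>i\<in>{1..k}. A i) = A l \<union> (\<Union>i\<in>{1..k} - {l}. A i)" for A :: "nat \<Rightarrow> 'a set"
          using l by blast
        from this[of "\<lambda>i. set (c i)"] this[of "\<lambda>i. set (c' i)"]
        have U: "(\<Union>i\<in>{1..k}. set (c' i)) = set (c' l) \<union> (\<Union>i\<in>{1..k} - {l}. set (c i))"
          "(\<Union>i\<in>{1..k}. set (c i)) = set (c l) \<union> (\<Union>i\<in>{1..k} - {l}. set (c i))"
          using c'i by simp_all
        have "set (c l) \<subseteq> set (c' l)"
          unfolding cl c'l by auto
        then show ?thesis
          unfolding nodes_def U by blast
      qed
      then have "nodes k c' b = S"
        using c(2)[OF l] unfolding cl c'l S_def by auto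
      moreover have "exts S (Q \<union> {h} \<times> D \<union> D \<times> {z} \<union> rel_of (P @ Y)) = exts S (constr k c' b ts)"
      proof (rule exts_cong)
        fix R assume R: "linear_order_on S R"
        have "rel_of (h # (P @ Y) @ [z]) =
            {(h, h), (h, z), (z, z)} \<union> {h} \<times> D \<union> D \<times> {z} \<union> rel_of (P @ Y)"
          by (auto simp: rel_of_append D_def)
        then have 1: "rel_of (c' l) \<subseteq> R \<longleftrightarrow> (h, z) \<in> R \<and> {h} \<times> D \<union> D \<times> {z} \<union> rel_of (P @ Y) \<subseteq> R"
          unfolding c'l using refl[OF R] by simp
        have 2: "(\<forall>i\<in>{1..k} - {l}. rel_of (c' i) \<subseteq> R) \<longleftrightarrow> (\<forall>i\<in>{1..k} - {l}. rel_of (c i) \<subseteq> R)"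
          using c'i by simp
        have 3: "hd (c' i) = hd (c i)" "last (c' i) = last (c i)" for i
          using cl by (auto simp: c'_def)
        show "Q \<union> {h} \<times> D \<union> D \<times> {z} \<union> rel_of (P @ Y) \<subseteq> R \<longleftrightarrow> constr k c' b ts \<subseteq> R"
          unfolding Q_def Un_subset_iff UN_subset_iff insert_subset constr_subset_iff split 2 3
          using 1 unfolding Un_subset_iff by argo
      qed
      ultimately show ?thesis by simp
    qed
    moreover have "card (exts (nodes k c' b) (constr k c' b ts)) =
        count_exts k ts (\<lambda>i. length (c i) + (if i = l then length P else 0)) (\<lambda>i. length (b i))"
    proof -
      have "separated k c' b"
      proof -
        have sub: "set (c' i) \<subseteq> set (c i) \<union> (if i = l then set P else {})" for i
          using cl by (auto simp: c'_def)
        have Pc: "set P \<inter> set (c i) = {}" if "i \<in> {1..k}" for i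
          using c(2)[OF that] P(2) by blast
        have Pb: "set P \<inter> set (b i) = {}" if "i \<in> {1..<k}" for i
          using nodesI(2)[of i k _ b c, OF that] P(2) by blast
        have "distinct (c' l)"
          using c[OF l] P cl unfolding c'l by auto
        then have "c' i \<noteq> []" "distinct (c' i)" if "i \<in> {1..k}" for i
          using c[OF that] c'i c'l by (cases "i = l"; simp)+
        moreover have "set (c' i) \<inter> set (c' j) = {}" if "i \<in> {1..k}" "j \<in> {1..k}" "i \<noteq> j" for i j
        proof -
          have "set (c' i) \<inter> set (c' j) \<subseteq> set (c i) \<inter> set (c j) \<union> set P \<inter> set (c i) \<union> set P \<inter> set (c j)"
            using sub[of i] sub[of j] that(3) by (cases "i = l"; cases "j = l") auto
          then show ?thesis
            using separatedD(4)[OF sep that] Pc[OF that(1)] Pc[OF that(2)] by blast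
        qed
        moreover have "set (c' i) \<inter> set (b j) = {}" if "i \<in> {1..k}" "j \<in> {1..<k}" for i j
        proof -
          have "set (c' i) \<inter> set (b j) \<subseteq> set (c i) \<inter> set (b j) \<union> set P \<inter> set (b j)"
            using sub[of i] by (cases "i = l") auto
          then show ?thesis
            using separatedD(6)[OF sep that] Pb[OF that(2)] by blast
        qed
        ultimately show ?thesis
          using separatedD(3,5)[OF sep] unfolding separated_def by simp
      qed
      from card_exts_system[OF this ts] have "card (exts (nodes k c' b) (constr k c' b ts)) =
        count_exts k ts (\<lambda>i. length (c' i)) (\<lambda>i. length (b i))" .
      moreover have "length (c' i) = length (c i) + (if i = l then length P else 0)" for i
        using cl by (simp add: c'_def)
      ultimately show ?thesis by simp
    qed
    moreover have "binom (int (length (c l)) - 2 + int (length P)) (length P) =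
        (length P + length Y) choose length P"
      using cl by (simp add: binom_def add.commute nat_add_distrib)
    moreover have "hd (c l) = h" "last (c l) = z"
      using cl by simp_all
    ultimately show ?thesis
      unfolding S_def by simp
  qed
qed

section \<open>Summation over the numbers of elements in the gaps\<close>

lemma finite_bounded_lists: "finite {M :: nat list. length M = d \<and> sum_list M \<le> p}"
proof (rule finite_subset)
  show "{M. length M = d \<and> sum_list M \<le> p} \<subseteq> {M. set M \<subseteq> {..p} \<and> length M = d}"
    using member_le_sum_list by (fastforce intro: order_trans)
qed (simp add: finite_lists_length_eq)

lemma sum_bounded_lists_Suc:
  fixes F :: "nat list \<Rightarrow> nat"
  shows "(\<Sum>M | length M = Suc d \<and> sum_list M \<le> p. F M) =
    (\<Sum>m\<le>p. \<Sum>M | length M = d \<and> sum_list M \<le> p - m. F (m # M))"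
proof -
  have "(\<Sum>M | length M = Suc d \<and> sum_list M \<le> p. F M) =
      (\<Sum>(m, M)\<in>(SIGMA m:{..p}. {M. length M = d \<and> sum_list M \<le> p - m}). F (m # M))"
    by (rule sum.reindex_bij_witness[where j = "\<lambda>M. (hd M, tl M)" and i = "\<lambda>(m, M). m # M"])
      (auto simp: length_Suc_conv)
  then show ?thesis
    by (simp add: sum.Sigma finite_bounded_lists)
qed

lemma separated_append_link:
  assumes sep: "separated k c b" and j: "j \<in> {1..<k}"
    and T: "distinct T" "set T \<inter> nodes k c b = {}"
  shows "separated k c (b(j := b j @ T))"
proof -
  let ?b = "b(j := b j @ T)"
  have sub: "set (?b i) \<subseteq> set (b i) \<union> (if i = j then set T else {})" for i
    by auto
  have Tc: "set T \<inter> set (c i) = {}" if "i \<in> {1..k}" for i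
    using nodesI(1)[of i k _ c b, OF that] T(2) by blast
  have Tb: "set T \<inter> set (b i) = {}" if "i \<in> {1..<k}" for i
    using nodesI(2)[of i k _ b c, OF that] T(2) by blast
  have "distinct (?b i)" if "i \<in> {1..<k}" for i
    using separatedD(3)[OF sep that] T(1) Tb[OF that] by auto
  moreover have "set (?b i) \<inter> set (?b i') = {}" if "i \<in> {1..<k}" "i' \<in> {1..<k}" "i \<noteq> i'" for i i'
  proof -
    have "set (?b i) \<inter> set (?b i') \<subseteq> set (b i) \<inter> set (b i') \<union> set T \<inter> set (b i) \<union> set T \<inter> set (b i')"
      using sub[of i] sub[of i'] that(3) by (cases "i = j"; cases "i' = j") auto
    then show ?thesis
      using separatedD(5)[OF sep that] Tb[OF that(1)] Tb[OF that(2)] by blast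
  qed
  moreover have "set (c i) \<inter> set (?b i') = {}" if "i \<in> {1..k}" "i' \<in> {1..<k}" for i i'
  proof -
    have "set (c i) \<inter> set (?b i') \<subseteq> set (c i) \<inter> set (b i') \<union> set T \<inter> set (c i)"
      using sub[of i'] by (cases "i' = j") auto
    then show ?thesis
      using separatedD(6)[OF sep that] Tc[OF that(1)] by blast
  qed
  ultimately show ?thesis
    using separatedD(1,2,4)[OF sep] unfolding separated_def by simp
qed

text \<open>Induction on the number \<open>l - j\<close> of gaps left: \<open>card_exts_step\<close>
  settles one gap, \<open>card_exts_final\<close> the end at the chain \<open>l\<close>. The entry
  \<open>M ! i\<close> belongs to the gap \<open>j + i\<close>, and what is left of \<open>P\<close>
  after all gaps lengthens the chain \<open>l\<close>.\<close>

lemma card_exts_sum: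
  assumes "separated k c b" and ts: "set ts \<subseteq> {1..k}"
    and "1 \<le> j" "j \<le> l" and l: "l \<le> k"
    and "distinct P" "set P \<inter> nodes k c b = {}"
  shows "card (exts (nodes k c b \<union> set P) (constr k c b ts \<union> rel_of (hd (c j) # P @ [last (c l)]))) =
    (\<Sum>M | length M = l - j \<and> sum_list M \<le> length P.
      count_exts k ts (\<lambda>i. length (c i) + (if i = l then length P - sum_list M else 0))
        (\<lambda>i. length (b i) + (if j \<le> i \<and> i < l then M ! (i - j) else 0)) *
      binom (int (length (c l)) - 2 + int (length P) - int (sum_list M)) (length P - sum_list M) *
      (\<Prod>i<l - j. (length (b (j + i)) + M ! i) choose (M ! i)))"
  using assms(1,3,4,6,7)
proof (induction "l - j" arbitrary: j P b)
  case 0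
  then have "j = l"
    by simp
  have set: "{M. length M = l - j \<and> sum_list M \<le> length P} = {[]}"
    using 0 by auto
  have "(if l \<le> i \<and> i < l then x else 0) = (0 :: nat)" for i x
    by simp
  then show ?case
    unfolding set using card_exts_final[OF 0(2) ts, of l P] 0 l
    by (simp add: \<open>j = l\<close> del: rel_of.simps cong: if_cong)
next
  case (Suc d)
  have j: "j \<in> {1..<k}" "j < l" "1 \<le> Suc j" "Suc j \<le> l" "d = l - Suc j"
    using Suc.hyps(2) Suc.prems(2,3) l by auto
  \<comment> \<open>The summand claimed for \<open>j\<close>; the induction hypothesis for
    \<open>Suc j\<close> produces it at \<open>m # M\<close>.\<close>
  define F where "F M = count_exts k ts (\<lambda>i. length (c i) + (if i = l then length P - sum_list M else 0))
        (\<lambda>i. length (b i) + (if j \<le> i \<and> i < l then M ! (i - j) else 0)) *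
      binom (int (length (c l)) - 2 + int (length P) - int (sum_list M)) (length P - sum_list M) *
      (\<Prod>i<Suc d. (length (b (j + i)) + M ! i) choose (M ! i))" for M
  have "card (exts (nodes k c b \<union> set P) (constr k c b ts \<union> rel_of (hd (c j) # P @ [last (c l)]))) =
    (\<Sum>m\<le>length P. ((length (b j) + m) choose m) *
      card (exts (nodes k c (b(j := b j @ take m P)) \<union> set (drop m P))
        (constr k c (b(j := b j @ take m P)) ts \<union>
          rel_of (hd (c (Suc j)) # drop m P @ [last (c l)]))))"
    using card_exts_step[OF Suc.prems(1) ts _ j(2) l Suc.prems(4,5)] j(1) by simp
  also have "\<dots> = (\<Sum>m\<le>length P. \<Sum>M | length M = d \<and> sum_list M \<le> length P - m. F (m # M))"
  proof (rule sum.cong[OF refl])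
    fix m assume "m \<in> {..length P}"
    then have m: "m \<le> length P" by simp
    let ?b = "b(j := b j @ take m P)"
    have sep: "separated k c ?b"
      using separated_append_link[OF Suc.prems(1) j(1)] Suc.prems(4,5) set_take_subset[of m P]
      by (meson disjoint_iff distinct_take subsetD)
    have "nodes k c ?b \<subseteq> nodes k c b \<union> set (take m P)"
    proof -
      have "set (?b i) \<subseteq> set (b i) \<union> set (take m P)" for i
        by auto
      then show ?thesis
        unfolding nodes_def by blast
    qed
    moreover have "set (take m P) \<inter> set (drop m P) = {}"
      using Suc.prems(4) by (simp add: set_take_disj_set_drop_if_distinct)
    ultimately have disj: "set (drop m P) \<inter> nodes k c ?b = {}"
      using Suc.prems(5) set_drop_subset[of m P] by blast
    have IH: "card (exts (nodes k c ?b \<union> set (drop m P))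
        (constr k c ?b ts \<union> rel_of (hd (c (Suc j)) # drop m P @ [last (c l)]))) =
      (\<Sum>M | length M = d \<and> sum_list M \<le> length P - m.
        count_exts k ts (\<lambda>i. length (c i) + (if i = l then length P - m - sum_list M else 0))
          (\<lambda>i. length (?b i) + (if Suc j \<le> i \<and> i < l then M ! (i - Suc j) else 0)) *
        binom (int (length (c l)) - 2 + int (length P - m) - int (sum_list M)) (length P - m - sum_list M) *
        (\<Prod>i<d. (length (?b (Suc j + i)) + M ! i) choose (M ! i)))"
      using Suc.hyps(1)[OF j(5) sep j(3,4) _ disj] Suc.prems(4) by (simp only: j(5) length_drop distinct_drop)
    show "((length (b j) + m) choose m) *
      card (exts (nodes k c ?b \<union> set (drop m P))
        (constr k c ?b ts \<union> rel_of (hd (c (Suc j)) # drop m P @ [last (c l)]))) =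
      (\<Sum>M | length M = d \<and> sum_list M \<le> length P - m. F (m # M))"
    proof (unfold IH, subst sum_distrib_left, rule sum.cong[OF refl])
      fix M assume M: "M \<in> {M. length M = d \<and> sum_list M \<le> length P - m}"
      \<comment> \<open>At the gap \<open>j\<close> the entry \<open>m\<close> is already counted in
        the longer link; at later gaps positions in \<open>m # M\<close> are shifted by one.\<close>
      have lens: "length (?b i) + (if Suc j \<le> i \<and> i < l then M ! (i - Suc j) else 0) =
          length (b i) + (if j \<le> i \<and> i < l then (m # M) ! (i - j) else 0)" for i
      proof (cases "i = j")
        case True
        have "length (take m P) = m"
          using m by simp
        then have "length (?b j) = length (b j) + m"
          by (simp only: fun_upd_same length_append)
        then show ?thesis
          unfolding True using j(2) by (simp only: le_refl simp_thms if_True if_False diff_self_eq_0 nth_Cons_0 not_less_eq_eq[symmetric] Suc_n_not_le_n add_0_right)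
      next
        case False
        then have "Suc j \<le> i \<longleftrightarrow> j \<le> i"
          by auto
        moreover have "(m # M) ! (i - j) = M ! (i - Suc j)" if "Suc j \<le> i"
        proof -
          have "i - j = Suc (i - Suc j)"
            using that by simp
          then show ?thesis by simp
        qed
        ultimately show ?thesis using False by simp
      qed
      have diff: "length P - m - sum_list M = length P - sum_list (m # M)"
        by simp
      have diff': "int (length (c l)) - 2 + int (length P - m) - int (sum_list M) =
          int (length (c l)) - 2 + int (length P) - int (sum_list (m # M))"
        using m by simp
      have prod: "(\<Prod>i<Suc d. (length (b (j + i)) + (m # M) ! i) choose ((m # M) ! i)) =
          ((length (b j) + m) choose m) * (\<Prod>i<d. (length (?b (Suc j + i)) + M ! i) choose (M ! i))"
        by (subst prod.lessThan_Suc_shift) simp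
      show "((length (b j) + m) choose m) *
        (count_exts k ts (\<lambda>i. length (c i) + (if i = l then length P - m - sum_list M else 0))
          (\<lambda>i. length (?b i) + (if Suc j \<le> i \<and> i < l then M ! (i - Suc j) else 0)) *
        binom (int (length (c l)) - 2 + int (length P - m) - int (sum_list M)) (length P - m - sum_list M) *
        (\<Prod>i<d. (length (?b (Suc j + i)) + M ! i) choose (M ! i))) = F (m # M)"
        unfolding F_def lens diff diff' prod by (simp only: mult_ac)
    qed
  qed
  also have "\<dots> = (\<Sum>M | length M = Suc d \<and> sum_list M \<le> length P. F M)"
    by (rule sum_bounded_lists_Suc[symmetric])
  finally show ?case
    unfolding F_def Suc.hyps(2) .
qed

text \<open>All of \<open>xs\<close> lies below all of \<open>S\<close> and in a prescribed order,
  so an extension is determined by its restriction to \<open>S\<close>, and every extension on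
  \<open>S\<close> occurs.\<close>

lemma card_exts_prefix:
  assumes xs: "distinct xs" "set xs \<inter> S = {}" and fin: "finite S" and Q: "Q \<subseteq> S \<times> S"
  shows "card (exts (set xs \<union> S) (Q \<union> rel_of xs \<union> set xs \<times> S)) = card (exts S Q)"
proof -
  let ?h = "\<lambda>R. rel_of xs \<union> set xs \<times> S \<union> R"
  have lin: "linear_order_on (set xs \<union> S) (?h R)" if "linear_order_on S R" for R
  proof -
    obtain ys where "distinct ys" "set ys = S" "rel_of ys = R"
      using linear_order_on_imp_list[OF fin \<open>linear_order_on S R\<close>] by blast
    then show ?thesis
      using linear_order_on_rel_of[of "xs @ ys"] xs by (simp add: rel_of_append)
  qed
  have res: "?h R \<inter> S \<times> S = R" if "linear_order_on S R" for R
    using that xs rel_of_subset[of xs] unfolding linear_order_on_iff by blast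
  have "bij_betw ?h (exts S Q) (exts (set xs \<union> S) (Q \<union> rel_of xs \<union> set xs \<times> S))"
  proof (rule bij_betw_byWitness[where f' = "\<lambda>R. R \<inter> S \<times> S"])
    show "\<forall>R\<in>exts S Q. ?h R \<inter> S \<times> S = R"
      using res by (simp add: exts_def)
    show "\<forall>R\<in>exts (set xs \<union> S) (Q \<union> rel_of xs \<union> set xs \<times> S). ?h (R \<inter> S \<times> S) = R"
    proof
      fix R assume "R \<in> exts (set xs \<union> S) (Q \<union> rel_of xs \<union> set xs \<times> S)"
      then have R: "linear_order_on (set xs \<union> S) R" "rel_of xs \<union> set xs \<times> S \<subseteq> R"
        by (auto simp: exts_def)
      show "?h (R \<inter> S \<times> S) = R"
      proof (rule linear_order_on_subset_eq)
        show "linear_order_on (set xs \<union> S) (?h (R \<inter> S \<times> S))"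
          by (intro lin linear_order_on_Int[OF R(1)]) simp
      qed (use R in auto)
    qed
    show "?h ` exts S Q \<subseteq> exts (set xs \<union> S) (Q \<union> rel_of xs \<union> set xs \<times> S)"
      using lin by (auto simp: exts_def)
    show "(\<lambda>R. R \<inter> S \<times> S) ` exts (set xs \<union> S) (Q \<union> rel_of xs \<union> set xs \<times> S) \<subseteq> exts S Q"
      using linear_order_on_Int[of "set xs \<union> S" _ S] Q by (auto simp: exts_def)
  qed
  then show ?thesis
    by (simp add: bij_betw_same_card)
qed

section \<open>Removing a one-element chain\<close>

text \<open>Pairs from \<open>xs\<close> to \<open>ys\<close> come through \<open>u\<close>. This
  fuses the two links around a removed chain, and a chain with the tops above its greatest
  element.\<close>

lemma rel_of_join:
  assumes "trans R"
  shows "rel_of (xs @ u # ys) \<subseteq> R \<longleftrightarrow> rel_of (xs @ [u]) \<subseteq> R \<and> rel_of (u # ys) \<subseteq> R"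
proof
  assume "rel_of (xs @ [u]) \<subseteq> R \<and> rel_of (u # ys) \<subseteq> R"
  then have *: "rel_of xs \<subseteq> R" "rel_of (u # ys) \<subseteq> R" "\<And>x. x \<in> set xs \<Longrightarrow> (x, u) \<in> R"
    "\<And>y. y \<in> set ys \<Longrightarrow> (u, y) \<in> R"
    by (auto simp: rel_of_append)
  then have "(x, y) \<in> R" if "x \<in> set xs" "y \<in> set ys" for x y
    using that assms by (meson transD)
  then show "rel_of (xs @ u # ys) \<subseteq> R"
    using * by (auto simp: rel_of_append simp del: rel_of.simps)
qed (auto simp: rel_of_append)

text \<open>Removing a one-element chain \<open>n\<close> turns its element into a link, unless \<open>n = 1\<close>: then it
  starts the initial segment below the chain 2, which all linear extensions share.\<close>

lemma count_exts_remove: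
  assumes n: "1 \<le> n" "n < k" "v n = 1" and v: "\<And>i. i \<in> {1..k} \<Longrightarrow> v i > 0"
    and ts: "set ts \<subseteq> {1..k} - {n}"
  shows "count_exts k ts v w = count_exts (k - 1) (map (\<lambda>i. if i < n then i else i - 1) ts)
    (\<lambda>i. v (if i < n then i else Suc i))
    (\<lambda>i. if Suc i < n then w i else if Suc i = n then w i + 1 + w n else w (Suc i))"
proof -
  define c where "c = std_chain v"
  define b where "b = std_link w"
  define u where "u = Chain n 0"
  \<comment> \<open>Enumerates the indices other than \<open>n\<close> in increasing order.\<close>
  define e where "e i = (if i < n then i else Suc i)" for i
  define ts' where "ts' = map (\<lambda>i. if i < n then i else i - 1) ts"
  define c' where "c' i = c (e i)" for i
  \<comment> \<open>The links on both sides of the chain \<open>n\<close> become one with its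
    element \<open>u\<close> between them, whence the \<open>+ 1\<close> in the lengths. For
    \<open>n = 1\<close> no index in the range satisfies \<open>Suc i = n\<close>, and the link 1
    drops out.\<close>
  define b' where "b' i = (if Suc i < n then b i else if Suc i = n then b i @ u # b n else b (Suc i))" for i
  have sep: "separated k c b"
    unfolding c_def b_def using v by (rule separated_std)
  have len: "length (c i) = v i" "length (b i) = w i" for i
    by (simp_all add: c_def b_def std_chain_def std_link_def del: upt_Suc)
  have cn: "c n = [u]"
    by (simp add: c_def std_chain_def u_def n)
  have nk: "n \<in> {1..k}"
    using n by simp
  have e: "e i \<in> {1..k} - {n}" if "i \<in> {1..k - 1}" for i
    using that n by (auto simp: e_def)
  have e_inj: "e i \<noteq> e j" if "i \<noteq> j" for i j
    using that by (auto simp: e_def)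
  have e_surj: "i \<in> e ` {1..k - 1}" if "i \<in> {1..k} - {n}" for i
  proof (cases "i < n")
    case True
    then show ?thesis
      using that n by (intro image_eqI[of _ _ i]) (auto simp: e_def)
  next
    case False
    then show ?thesis
      using that n by (intro image_eqI[of _ _ "i - 1"]) (auto simp: e_def)
  qed
  have e_image: "e ` {1..k - 1} = {1..k} - {n}"
    using e e_surj by blast
  have tsD: "1 \<le> i" "i \<le> k" "i \<noteq> n" if "i \<in> set ts" for i
    using that ts by auto
  have ts': "set ts' \<subseteq> {1..k - 1}"
  proof
    fix j assume "j \<in> set ts'"
    then obtain i where "i \<in> set ts" "j = (if i < n then i else i - 1)"
      by (auto simp: ts'_def)
    then show "j \<in> {1..k - 1}"
      using tsD[of i] n by auto
  qed
  have tops: "map (\<lambda>i. last (c' i)) ts' = map (\<lambda>i. last (c i)) ts"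
  proof -
    have "e (if i < n then i else i - 1) = i" if "i \<in> set ts" for i
      using tsD[OF that] n by (auto simp: e_def)
    then show ?thesis
      by (simp add: ts'_def c'_def)
  qed
  have hd': "hd (c' i) = hd (c (e i))" for i
    by (simp add: c'_def)
  have u: "u \<in> nodes k c b" "\<And>i. i \<in> {1..k} - {n} \<Longrightarrow> u \<notin> set (c i)" "\<And>i. i \<in> {1..<k} \<Longrightarrow> u \<notin> set (b i)"
    using nodesI(1)[OF nk, of u c b] cn separatedD(4)[OF sep nk] separatedD(6)[OF sep nk] by auto
  have b'_sub: "set (b' i) \<subseteq> set (b i) \<union> set (b (Suc i)) \<union> {u}" for i
    by (auto simp: b'_def)
  have sep': "separated (k - 1) c' b'"
  proof -
    have "c' i \<noteq> []" "distinct (c' i)" if "i \<in> {1..k - 1}" for i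
      using separatedD(1,2)[OF sep] e[OF that] by (auto simp: c'_def)
    moreover have "set (c' i) \<inter> set (c' j) = {}" if "i \<in> {1..k - 1}" "j \<in> {1..k - 1}" "i \<noteq> j" for i j
      using separatedD(4)[OF sep] e[OF that(1)] e[OF that(2)] e_inj[OF that(3)] by (simp add: c'_def)
    moreover have "distinct (b' i)" if "i \<in> {1..<k - 1}" for i
    proof -
      have i: "i \<in> {1..<k}" "Suc i \<in> {1..<k}"
        using that by auto
      then show ?thesis
        using separatedD(3)[OF sep i(1)] separatedD(3)[OF sep i(2)] separatedD(5)[OF sep i] u(3)[OF i(1)] u(3)[OF i(2)]
        by (auto simp: b'_def)
    qed
    moreover have "set (c' i) \<inter> set (b' j) = {}" if "i \<in> {1..k - 1}" "j \<in> {1..<k - 1}" for i j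
    proof -
      have j: "j \<in> {1..<k}" "Suc j \<in> {1..<k}"
        using that by auto
      have i: "e i \<in> {1..k}" using e[OF that(1)] by simp
      show ?thesis
        using b'_sub[of j] separatedD(6)[OF sep i j(1)] separatedD(6)[OF sep i j(2)] u(2)[OF e[OF that(1)]]
        unfolding c'_def by blast
    qed
    \<comment> \<open>The old links that make up \<open>b' i\<close> and \<open>b' j\<close> have
      different indices, and \<open>u\<close> occurs only in the new link with
      \<open>Suc i = n\<close>.\<close>
    moreover have less: "set (b' i) \<inter> set (b' j) = {}" if "i \<in> {1..<k - 1}" "j \<in> {1..<k - 1}" "i < j" for i j
    proof -
      have ij: "i \<in> {1..<k}" "Suc i \<in> {1..<k}" "j \<in> {1..<k}" "Suc j \<in> {1..<k}"
        using that by auto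
      have *: "set (b i') \<inter> set (b j') = {}" if "i' \<in> {i, Suc i}" "j' \<in> {j, Suc j}" "i' \<noteq> j'" for i' j'
        by (rule separatedD(5)[OF sep]) (use that ij in auto)
      consider "Suc j < n" | "Suc j = n" | "Suc i = n" "n < Suc j" | "Suc i < n" "n < Suc j" | "n < Suc i"
        by linarith
      then show ?thesis
        using * u(3)[OF ij(1)] u(3)[OF ij(2)] u(3)[OF ij(3)] u(3)[OF ij(4)] that(3)
        by cases (simp_all add: b'_def Int_Un_distrib Int_Un_distrib2)
    qed
    have "set (b' i) \<inter> set (b' j) = {}" if "i \<in> {1..<k - 1}" "j \<in> {1..<k - 1}" "i \<noteq> j" for i j
      using less[of i j] less[of j i] that by (cases i j rule: linorder_cases) auto
    ultimately show ?thesis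
      unfolding separated_def by simp
  qed
  have "card (exts (nodes k c b) (constr k c b ts)) =
      card (exts (nodes (k - 1) c' b') (constr (k - 1) c' b' ts'))"
  proof (cases "n = 1")
    case True
    define S where "S = nodes (k - 1) c' b'"
    have e1: "e i = Suc i" if "i \<in> {1..k - 1}" for i
      using that by (simp add: e_def True)
    have b'1: "b' i = b (Suc i)" if "i \<in> {1..<k - 1}" for i
      using that by (simp add: b'_def True)
    have S: "S = (\<Union>i\<in>{2..k}. set (c i)) \<union> (\<Union>i\<in>{2..<k}. set (b i))"
    proof -
      have 2: "{2..k} = Suc ` {1..k - 1}" "{2..<k} = Suc ` {1..<k - 1}"
        using n by (simp_all add: numeral_2_eq_2 image_Suc_atLeastAtMost image_Suc_atLeastLessThan)
      have "S = (\<Union>i\<in>{1..k - 1}. set (c (Suc i))) \<union> (\<Union>i\<in>{1..<k - 1}. set (b (Suc i)))"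
        using e1 b'1 by (simp add: S_def nodes_def c'_def)
      then show ?thesis
        by (simp only: 2 image_image)
    qed
    have 1: "{1..k} = insert 1 {2..k}" "{1..<k} = insert 1 {2..<k}"
      using n by auto
    have N: "nodes k c b = set (u # b 1) \<union> S"
      unfolding nodes_def S 1 using cn True by auto
    have disj: "set (u # b 1) \<inter> S = {}"
    proof -
      have "set (b 1) \<inter> set (c i) = {}" if "i \<in> {2..k}" for i
        by (rule separatedD(7)[OF sep]) (use that n in auto)
      moreover have "set (b 1) \<inter> set (b i) = {}" if "i \<in> {2..<k}" for i
        by (rule separatedD(5)[OF sep]) (use that n in auto)
      moreover have "u \<notin> set (c i)" if "i \<in> {2..k}" for i
        by (rule u(2)) (use that True in auto)
      moreover have "u \<notin> set (b i)" if "i \<in> {2..<k}" for i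
        by (rule u(3)) (use that in auto)
      ultimately have "set (b 1) \<inter> S = {}" "u \<notin> S"
        unfolding S by (simp_all add: Int_Un_distrib Int_UN_distrib)
      then show ?thesis by simp
    qed
    have dist: "distinct (u # b 1)"
      using separatedD(3)[OF sep, of 1] u(3)[of 1] n True by simp
    have "exts (nodes k c b) (constr k c b ts) =
        exts (set (u # b 1) \<union> S) (constr (k - 1) c' b' ts' \<union> rel_of (u # b 1) \<union> set (u # b 1) \<times> S)"
      unfolding N
    proof (rule exts_cong)
      fix R assume R: "linear_order_on (set (u # b 1) \<union> S) R"
      then have tr: "trans R"
        by (simp add: linear_order_on_iff)
      \<comment> \<open>\<open>h\<close> turns out to be the least element of \<open>S\<close>, so
        the segment \<open>u # b 1\<close> lies below all of \<open>S\<close> iff it lies below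
        \<open>h\<close>.\<close>
      define h where "h = hd (c 2)"
      have h: "h \<in> S"
      proof -
        have "c 2 \<noteq> []"
          by (rule separatedD(1)[OF sep]) (use n in auto)
        then show ?thesis
          using n unfolding S h_def by (auto intro!: bexI[of _ 2])
      qed
      have refl: "(u, u) \<in> R" "(h, h) \<in> R"
        using linear_order_on_refl[OF R] h by auto
      have K: "constr k c b ts \<subseteq> R \<longleftrightarrow> constr (k - 1) c' b' ts' \<subseteq> R \<and> rel_of (u # b 1 @ [h]) \<subseteq> R"
      proof -
        have "(\<forall>i\<in>{1..k}. rel_of (c i) \<subseteq> R) \<longleftrightarrow> (\<forall>i\<in>{1..k - 1}. rel_of (c' i) \<subseteq> R)"
        proof -
          have "(\<forall>i\<in>{1..k - 1}. rel_of (c' i) \<subseteq> R) \<longleftrightarrow> (\<forall>i\<in>e ` {1..k - 1}. rel_of (c i) \<subseteq> R)"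
            by (simp add: c'_def)
          moreover have "rel_of (c n) \<subseteq> R"
            using cn refl by simp
          ultimately show ?thesis
            unfolding e_image using nk by blast
        qed
        moreover have "(\<forall>i\<in>{1..<k}. rel_of (hd (c i) # b i @ [hd (c (Suc i))]) \<subseteq> R) \<longleftrightarrow>
            (\<forall>i\<in>{1..<k - 1}. rel_of (hd (c' i) # b' i @ [hd (c' (Suc i))]) \<subseteq> R) \<and> rel_of (u # b 1 @ [h]) \<subseteq> R"
        proof -
          have "(\<forall>i\<in>{1..<k - 1}. rel_of (hd (c' i) # b' i @ [hd (c' (Suc i))]) \<subseteq> R) \<longleftrightarrow>
              (\<forall>i\<in>{1..<k - 1}. rel_of (hd (c (Suc i)) # b (Suc i) @ [hd (c (Suc (Suc i)))]) \<subseteq> R)"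
          proof (rule ball_cong[OF HOL.refl])
            fix i assume i: "i \<in> {1..<k - 1}"
            have "c' i = c (Suc i)" "c' (Suc i) = c (Suc (Suc i))"
              using i by (simp_all add: c'_def e_def True)
            then show "rel_of (hd (c' i) # b' i @ [hd (c' (Suc i))]) \<subseteq> R \<longleftrightarrow>
                rel_of (hd (c (Suc i)) # b (Suc i) @ [hd (c (Suc (Suc i)))]) \<subseteq> R"
              by (simp only: b'1[OF i])
          qed
          also have "\<dots> \<longleftrightarrow> (\<forall>i\<in>Suc ` {1..<k - 1}. rel_of (hd (c i) # b i @ [hd (c (Suc i))]) \<subseteq> R)"
            by (simp only: ball_simps)
          also have "Suc ` {1..<k - 1} = {2..<k}"
            using n by (simp add: numeral_2_eq_2 image_Suc_atLeastLessThan)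
          finally show ?thesis
            unfolding 1 using cn True by (auto simp: h_def numeral_2_eq_2 simp del: rel_of.simps)
        qed
        ultimately show ?thesis
          unfolding constr_subset_iff tops by blast
      qed
      have above: "(h, y) \<in> R" if K: "constr k c b ts \<subseteq> R" and "y \<in> S" for y
      proof -
        have h': "(h, hd (c i)) \<in> R" if "i \<in> {2..k}" for i
          unfolding h_def by (rule hd_le_hd[OF tr K separatedD(1)[OF sep]]) (use that in auto)
        consider i where "i \<in> {2..k}" "y \<in> set (c i)" | i where "i \<in> {2..<k}" "y \<in> set (b i)"
          using \<open>y \<in> S\<close> unfolding S by blast
        then show ?thesis
        proof cases
          case 1
          then have "(hd (c i), y) \<in> R"
            by (intro hd_le[OF tr K]) auto
          then show ?thesis using h'[OF 1(1)] tr by (meson transD)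
        next
          case 2
          then have "rel_of (hd (c i) # b i @ [hd (c (Suc i))]) \<subseteq> R"
            using K unfolding constr_subset_iff by simp
          then have "(hd (c i), y) \<in> R" using 2 by auto
          moreover have "(h, hd (c i)) \<in> R" using h' 2 by simp
          ultimately show ?thesis using tr by (meson transD)
        qed
      qed
      show "constr k c b ts \<subseteq> R \<longleftrightarrow>
          constr (k - 1) c' b' ts' \<union> rel_of (u # b 1) \<union> set (u # b 1) \<times> S \<subseteq> R"
      proof
        assume L: "constr k c b ts \<subseteq> R"
        then have 1: "constr (k - 1) c' b' ts' \<subseteq> R" "rel_of ((u # b 1) @ [h]) \<subseteq> R"
          using K by auto
        then have 2: "rel_of (u # b 1) \<subseteq> R" "\<And>x. x \<in> set (u # b 1) \<Longrightarrow> (x, h) \<in> R"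
          unfolding rel_of_append by auto
        have "(x, y) \<in> R" if "x \<in> set (u # b 1)" "y \<in> S" for x y
          using 2(2)[OF that(1)] above[OF L that(2)] tr by (meson transD)
        then show "constr (k - 1) c' b' ts' \<union> rel_of (u # b 1) \<union> set (u # b 1) \<times> S \<subseteq> R"
          using 1 2 by blast
      next
        assume A: "constr (k - 1) c' b' ts' \<union> rel_of (u # b 1) \<union> set (u # b 1) \<times> S \<subseteq> R"
        have "rel_of ((u # b 1) @ [h]) \<subseteq> R"
          unfolding rel_of_append using A h refl by auto
        then show "constr k c b ts \<subseteq> R"
          using K A by simp
      qed
    qed
    moreover have "constr (k - 1) c' b' ts' \<subseteq> S \<times> S"
      unfolding S_def by (rule constr_subset[OF separatedD(1)[OF sep'] ts'])
    moreover have "finite S"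
      by (simp add: S_def finite_nodes)
    ultimately show ?thesis
      using card_exts_prefix[OF dist disj] by (simp add: S_def)
  next
    case False
    then have n1: "1 < n"
      using n by simp
    \<comment> \<open>The link \<open>p\<close> leads from the chain \<open>n - 1\<close> to the
      chain \<open>n\<close>; its index is that of the fused link.\<close>
    define p where "p = n - 1"
    have p: "n = Suc p" "1 \<le> p" "p < k - 1"
      using n n1 by (auto simp: p_def)
    have pn: "p \<in> {1..<k}" "n \<in> {1..<k}" "p \<in> {1..<k - 1}"
      using n p by auto
    have link: "(\<Union>i\<in>{1..<k}. A i) = (\<Union>i\<in>{1..<k} - {p, n}. A i) \<union> A p \<union> A n" for A :: "nat \<Rightarrow> node set"
      using pn by blast
    have link': "(\<Union>i\<in>{1..<k - 1}. A i) = (\<Union>i\<in>{1..<k - 1} - {p}. A i) \<union> A p" for A :: "nat \<Rightarrow> node set"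
      using pn by blast
    have rest: "{1..<k} - {p, n} = e ` ({1..<k - 1} - {p})"
    proof (intro equalityI subsetI)
      fix i assume i: "i \<in> {1..<k} - {p, n}"
      show "i \<in> e ` ({1..<k - 1} - {p})"
      proof (cases "i < n")
        case True
        then show ?thesis
          using i n p by (intro image_eqI[of _ _ i]) (auto simp: e_def)
      next
        case False
        then show ?thesis
          using i n p by (intro image_eqI[of _ _ "i - 1"]) (auto simp: e_def)
      qed
    qed (use p in \<open>auto simp: e_def split: if_splits\<close>)
    have b'p: "b' p = b p @ u # b n"
      by (simp add: b'_def p)
    have b'e: "b' i = b (e i)" "e (Suc i) = Suc (e i)" if "i \<noteq> p" for i
      using that p by (auto simp: b'_def e_def)
    have ep: "e p = p" "e n = Suc n"
      by (simp_all add: e_def p)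
    have N: "nodes k c b = nodes (k - 1) c' b'"
    proof -
      have "(\<Union>i\<in>{1..<k - 1} - {p}. set (b' i)) = (\<Union>i\<in>{1..<k} - {p, n}. set (b i))"
        unfolding rest using b'e by simp
      then have "(\<Union>i\<in>{1..<k - 1}. set (b' i)) = (\<Union>i\<in>{1..<k}. set (b i)) \<union> {u}"
        unfolding link link' b'p by auto
      moreover have "(\<Union>i\<in>{1..k - 1}. set (c' i)) = (\<Union>i\<in>{1..k} - {n}. set (c i))"
        unfolding e_image[symmetric] by (simp add: c'_def)
      moreover have "(\<Union>i\<in>{1..k}. set (c i)) = (\<Union>i\<in>{1..k} - {n}. set (c i)) \<union> {u}"
        using cn nk by auto
      ultimately show ?thesis
        unfolding nodes_def by (simp only: Un_ac)
    qed
    have "exts (nodes k c b) (constr k c b ts) = exts (nodes k c b) (constr (k - 1) c' b' ts')"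
    proof (rule exts_cong)
      fix R assume R: "linear_order_on (nodes k c b) R"
      then have tr: "trans R" and "(u, u) \<in> R"
        using linear_order_on_refl[OF R u(1)] by (simp_all add: linear_order_on_iff)
      have "(\<forall>i\<in>{1..k}. rel_of (c i) \<subseteq> R) \<longleftrightarrow> (\<forall>i\<in>{1..k - 1}. rel_of (c' i) \<subseteq> R)"
      proof -
        have "(\<forall>i\<in>{1..k - 1}. rel_of (c' i) \<subseteq> R) \<longleftrightarrow> (\<forall>i\<in>e ` {1..k - 1}. rel_of (c i) \<subseteq> R)"
          by (simp add: c'_def)
        moreover have "rel_of (c n) \<subseteq> R"
          using cn \<open>(u, u) \<in> R\<close> by simp
        ultimately show ?thesis
          unfolding e_image using nk by blast
      qed
      moreover have "(\<forall>i\<in>{1..<k}. rel_of (hd (c i) # b i @ [hd (c (Suc i))]) \<subseteq> R) \<longleftrightarrow>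
          (\<forall>i\<in>{1..<k - 1}. rel_of (hd (c' i) # b' i @ [hd (c' (Suc i))]) \<subseteq> R)"
      proof -
        have "rel_of (hd (c' i) # b' i @ [hd (c' (Suc i))]) =
            rel_of (hd (c (e i)) # b (e i) @ [hd (c (Suc (e i)))])" if "i \<noteq> p" for i
          using b'e[OF that] by (simp only: c'_def)
        then have "(\<forall>i\<in>{1..<k - 1} - {p}. rel_of (hd (c' i) # b' i @ [hd (c' (Suc i))]) \<subseteq> R) \<longleftrightarrow>
            (\<forall>i\<in>{1..<k} - {p, n}. rel_of (hd (c i) # b i @ [hd (c (Suc i))]) \<subseteq> R)"
          unfolding rest by (simp only: ball_simps) blast
        \<comment> \<open>\<open>u\<close> is the whole chain \<open>n\<close>, so the constraints
          of the two old links meet at \<open>u\<close>.\<close>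
        moreover have "rel_of (hd (c' p) # b' p @ [hd (c' (Suc p))]) \<subseteq> R \<longleftrightarrow>
            rel_of (hd (c p) # b p @ [hd (c (Suc p))]) \<subseteq> R \<and> rel_of (hd (c n) # b n @ [hd (c (Suc n))]) \<subseteq> R"
          using rel_of_join[OF tr, of "hd (c p) # b p" u "b n @ [hd (c (Suc n))]"] cn
          by (simp add: c'_def ep b'p p(1)[symmetric] del: rel_of.simps)
        moreover have "(\<forall>i\<in>{1..<k}. A i) \<longleftrightarrow> (\<forall>i\<in>{1..<k} - {p, n}. A i) \<and> A p \<and> A n" for A
          using pn by blast
        moreover have "(\<forall>i\<in>{1..<k - 1}. A i) \<longleftrightarrow> (\<forall>i\<in>{1..<k - 1} - {p}. A i) \<and> A p" for A
          using pn by blast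
        ultimately show ?thesis by presburger
      qed
      ultimately show "constr k c b ts \<subseteq> R \<longleftrightarrow> constr (k - 1) c' b' ts' \<subseteq> R"
        unfolding constr_subset_iff tops by blast
    qed
    then show ?thesis
      by (simp add: N)
  qed
  also have "\<dots> = count_exts (k - 1) ts' (\<lambda>i. length (c' i)) (\<lambda>i. length (b' i))"
    by (rule card_exts_system[OF sep' ts'])
  also have "(\<lambda>i. length (c' i)) = (\<lambda>i. v (if i < n then i else Suc i))"
    by (simp add: c'_def e_def len)
  also have "(\<lambda>i. length (b' i)) =
      (\<lambda>i. if Suc i < n then w i else if Suc i = n then w i + 1 + w n else w (Suc i))"
    by (auto simp: b'_def len)
  finally show ?thesis
    by (simp only: count_exts_def c_def b_def ts'_def)
qed

lemma count_exts_single_chain: "v 1 > 0 \<Longrightarrow> count_exts 1 [1] v w = 1"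
proof -
  assume "v 1 > 0"
  define c where "c = std_chain v"
  have c: "c 1 \<noteq> []" "distinct (c 1)"
    using \<open>v 1 > 0\<close> by (simp_all add: c_def std_chain_def distinct_map inj_on_def)
  have "rel_of (c 1) \<union> {(last (c 1), last (c 1))} = rel_of (c 1)"
    using refl_rel_of[of "last (c 1)" "c 1"] c by auto
  then have "count_exts 1 [1] v w = card (exts (set (c 1)) (rel_of (c 1)))"
    unfolding count_exts_def nodes_def constr_def c_def by simp
  then show ?thesis
    using card_exts_rel_of[OF c(2)] by simp
qed

section \<open>The recursion\<close>

lemma card_le_Diff_singleton:
  assumes "x \<in> {1..k} - {n}" "1 \<le> n"
  shows "card {y \<in> {1..k} - {n}. y \<le> x} = (if x < n then x else x - 1)"
proof -
  have "{y \<in> {1..k} - {n}. y \<le> x} = {1..x} - {n}"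
    using assms by auto
  then show ?thesis
    using assms by (simp add: card_Diff_singleton_if)
qed

text \<open>Only \<open>n\<close> is missing among the entries, so entries above \<open>n\<close>
  have a rank lower by one. This is the renumbering in \<open>count_exts_remove\<close>.\<close>

lemma map_Std:
  assumes "set z = {1..k} - {n}" "1 \<le> n"
  shows "map (Std z) [1..<Suc (length z)] = map (\<lambda>i. if i < n then i else i - 1) z"
proof (rule nth_equalityI)
  fix i assume "i < length (map (Std z) [1..<Suc (length z)])"
  then have i: "i < length z"
    by (simp del: upt_Suc)
  then have "z ! i \<in> {1..k} - {n}"
    using assms(1) nth_mem by blast
  have "Std z (Suc i) = card {y \<in> {1..k} - {n}. y \<le> z ! i}"
    using i by (simp add: Std_def assms(1))
  also have "\<dots> = (if z ! i < n then z ! i else z ! i - 1)"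
    by (rule card_le_Diff_singleton) fact+
  finally show "map (Std z) [1..<Suc (length z)] ! i = map (\<lambda>i. if i < n then i else i - 1) z ! i"
    using i by (simp del: upt_Suc)
qed (simp del: upt_Suc)

text \<open>After the merges the chain \<open>n\<close> consists of its least element only, and the
  chain \<open>l\<close> has one element more than the entry v_l + v_n minus the sum of
  \<open>M\<close> in \<open>f\<close>. Removing the chain \<open>n\<close> leads to the tuples
  given by \<open>f\<close>. For \<open>k = 2\<close> a single chain is left, which has one linear
  extension.\<close>

lemma count_exts_f:
  fixes V B M z :: "nat list"
  assumes k: "2 \<le> k" "length V = k" "length B = k - 1" and nl: "1 \<le> n" "n < l" "l \<le> k"
    and M: "length M = l - n" "sum_list M \<le> V !\<^sub>1 l + V !\<^sub>1 n"
    and z: "distinct z" "set z = {1..k} - {n}" and l: "l \<in> set z"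
  shows "count_exts k z
      (\<lambda>i. if i = n then 1 else if i = l then Suc (V !\<^sub>1 l + V !\<^sub>1 n - sum_list M) else Suc (V !\<^sub>1 i))
      (\<lambda>i. B !\<^sub>1 i + (if n \<le> i \<and> i < l then M ! (i - n) else 0)) =
    (if k = 2 then 1 else \<L> (G (f k n l M (V, B)) (Std z)))"
    (is "count_exts k z ?v ?w = _")
proof -
  define e where "e i = (if i < n then i else Suc i)" for i
  define w' where "w' i = (if Suc i < n then ?w i else if Suc i = n then ?w i + 1 + ?w n else ?w (Suc i))" for i
  let ?ts = "map (\<lambda>i. if i < n then i else i - 1) z"
  have *: "count_exts k z ?v ?w = count_exts (k - 1) ?ts (\<lambda>i. ?v (e i)) w'"
    unfolding w'_def e_def by (rule count_exts_remove) (use nl z in auto)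
  have len: "length z = k - 1"
    using distinct_card[OF z(1)] z(2) nl by simp
  have tsD: "set ?ts \<subseteq> {1..k - 1}"
  proof
    fix j assume "j \<in> set ?ts"
    then obtain i where i: "i \<in> set z" "j = (if i < n then i else i - 1)"
      by auto
    then have "1 \<le> i" "i \<le> k" "i \<noteq> n"
      using z by auto
    then show "j \<in> {1..k - 1}"
      using i nl by auto
  qed
  show ?thesis
  proof (cases "k = 2")
    case True
    then have "n = 1" "l = 2"
      using nl by auto
    have "{1..2} - {1} = {2 :: nat}"
      by auto
    then have "set z = {2}" "length z = 1"
      using z(2) len True \<open>n = 1\<close> by simp_all
    then obtain a where "z = [a]"
      by (metis One_nat_def length_0_conv length_Suc_conv)
    with \<open>set z = {2}\<close> have "z = [2]"
      by simp
    then have ts: "?ts = [1]"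
      using \<open>n = 1\<close> by simp
    have k1: "k - 1 = 1"
      using True by simp
    have "count_exts 1 [1] (\<lambda>i. ?v (e i)) w' = 1"
      by (rule count_exts_single_chain) simp
    then show ?thesis
      unfolding * ts k1 by (simp only: True refl if_True)
  next
    case False
    obtain V' B' where VB: "f k n l M (V, B) = (V', B')"
      by fastforce
    have V': "V' = map (\<lambda>i. V !\<^sub>1 i) [1..<n] @ map (\<lambda>i. V !\<^sub>1 i) [n + 1..<l] @
       [V !\<^sub>1 l + V !\<^sub>1 n - sum_list M] @ map (\<lambda>i. V !\<^sub>1 i) [l + 1..<k + 1]"
      using VB by (simp add: f_def)
    have lenV': "length V' = k - 1"
      using nl by (simp add: V' del: upt_Suc)
    have v: "?v (e i) = Suc (V' !\<^sub>1 i)" if "i \<in> {1..k - 1}" for i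
    proof -
      \<comment> \<open>The blocks of the first coordinate of \<open>f\<close>; the removal moves
        the chain \<open>l\<close> to the index \<open>l - 1\<close>.\<close>
      consider "i < n" | "n \<le> i" "Suc i < l" | "Suc i = l" | "l \<le> i"
        by linarith
      then show ?thesis
        using that nl by cases (auto simp: e_def V' nth_append simp del: upt_Suc)
    qed
    have w: "w' i = B' !\<^sub>1 i" if "i \<in> {1..<k - 1}" for i
    proof (cases "n = 1")
      case True
      \<comment> \<open>The first link, together with the m_1 elements merged into it, belonged to
        the initial segment; so the list starts with the second gap.\<close>
      then have B': "B' = map (\<lambda>i. B !\<^sub>1 i + M !\<^sub>1 i) [2..<l] @ map (\<lambda>i. B !\<^sub>1 i) [l..<k]"
        using VB by (simp add: f_def)
      consider "Suc i < l" | "l \<le> Suc i"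
        by linarith
      then show ?thesis
        using that nl True by cases (auto simp: w'_def B' nth_append simp del: upt_Suc)
    next
      case False
      define X where "X = map (\<lambda>i. B !\<^sub>1 i) [1..<n - 1]"
      define y where "y = B !\<^sub>1 (n - 1) + 1 + B !\<^sub>1 n + M !\<^sub>1 1"
      define Y where "Y = map (\<lambda>i. B !\<^sub>1 i + M !\<^sub>1 (i - n + 1)) [n + 1..<l]"
      define Z where "Z = map (\<lambda>i. B !\<^sub>1 i) [l..<k]"
      have B': "B' = X @ y # Y @ Z"
        using VB False by (simp add: f_def X_def y_def Y_def Z_def)
      have n2: "2 \<le> n"
        using False nl by simp
      have X: "length X = n - 2" "\<And>j. j < n - 2 \<Longrightarrow> X ! j = B ! j"
        by (simp_all add: X_def less_diff_conv)
      have Y: "length Y = l - n - 1" "\<And>j. j < l - n - 1 \<Longrightarrow> Y ! j = B ! (n + j) + M ! Suc j"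
        by (simp_all add: Y_def less_diff_conv add.commute[of n])
      have Z: "\<And>j. j < k - l \<Longrightarrow> Z ! j = B ! (l + j - 1)"
        by (simp add: Z_def less_diff_conv)
      have XY: "(X @ y # Y @ Z) ! (n - 2 + j) = (y # Y @ Z) ! j" for j
        using X(1) by (metis nth_append_length_plus)
      have YZ: "(Y @ Z) ! (l - n - 1 + j) = Z ! j" for j
        using Y(1) by (metis nth_append_length_plus)
      \<comment> \<open>The blocks of the second coordinate of \<open>f\<close>; the fused link has
        the index \<open>n - 1\<close>.\<close>
      consider "Suc i < n" | "Suc i = n" | "n \<le> i" "Suc i < l" | "l \<le> Suc i" "n \<le> i"
        by linarith
      then show ?thesis
      proof cases
        case 1
        then have "i - 1 < n - 2"
          using that by auto
        then have "B' ! (i - 1) = B ! (i - 1)"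
          unfolding B' using X by (simp add: nth_append)
        then show ?thesis
          using 1 by (simp add: w'_def)
      next
        case 2
        then have "i - 1 = n - 2 + 0"
          by auto
        then have "B' ! (i - 1) = y"
          unfolding B' by (simp only: XY nth_Cons_0)
        moreover have "w' i = y"
          using 2 nl by (auto simp: w'_def y_def)
        ultimately show ?thesis by simp
      next
        case 3
        then obtain j where j: "i = n + j"
          using le_Suc_ex by blast
        then have "i - 1 = n - 2 + Suc j" "j < l - n - 1"
          using n2 3 by auto
        then have "B' ! (i - 1) = B ! i + M ! Suc j"
          unfolding B' by (simp only: XY nth_Cons_Suc) (simp add: nth_append Y j)
        moreover have "w' i = B ! i + M ! Suc j"
          using 3 j by (simp add: w'_def)
        ultimately show ?thesis by simp
      next
        case 4
        then obtain j where j: "Suc i = l + j"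
          using le_Suc_ex by blast
        then have "i - 1 = n - 2 + Suc (l - n - 1 + j)" "j < k - l" "l + j - 1 = i"
          using n2 4 nl that by auto
        then have "B' ! (i - 1) = B ! i"
          unfolding B' by (simp only: XY nth_Cons_Suc YZ Z)
        moreover have "w' i = B ! i"
          using 4 by (simp add: w'_def)
        ultimately show ?thesis by simp
      qed
    qed
    have Std: "map (Std z) [1..<Suc (k - 1)] = ?ts"
      using map_Std[OF z(2) nl(1)] len by simp
    have "\<L> (G (V', B') (Std z)) = count_exts (k - 1) (map (Std z) [1..<Suc (k - 1)])
        (\<lambda>i. Suc (V' !\<^sub>1 i)) (\<lambda>i. B' !\<^sub>1 i)"
    proof (rule \<L>_G[OF lenV'])
      fix i assume "i \<in> {1..k - 1}"
      then have "Std z i \<in> set (map (Std z) [1..<Suc (k - 1)])"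
        by (auto simp del: upt_Suc)
      then show "Std z i \<in> {1..k - 1}"
        unfolding Std using tsD by (rule subsetD[rotated])
    qed
    also have "\<dots> = count_exts (k - 1) ?ts (\<lambda>i. ?v (e i)) w'"
      unfolding Std by (rule count_exts_cong[OF _ _ tsD]) (use v w in auto)
    finally show ?thesis
      using * False VB by simp
  qed
qed

text \<open>Common to both cases: \<open>E\<close> is what the chain \<open>l\<close> has become,
  \<open>P\<close> is the pendant part of the chain \<open>n\<close> and \<open>u\<close> its least
  element. The condition on the lengths says that \<open>u\<close>, \<open>P\<close> and
  \<open>E\<close> have as many elements as the two original chains.\<close>

lemma card_exts_pendant_chain:
  fixes V B z :: "nat list"
  assumes k: "2 \<le> k" "length V = k" "length B = k - 1" and nl: "1 \<le> n" "n < l" "l \<le> k"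
    and z: "distinct z" "set z = {1..k} - {n}"
    and c: "c = (std_chain (\<lambda>i. Suc (V !\<^sub>1 i)))(n := [u], l := E)" and b: "b = std_link (\<lambda>i. B !\<^sub>1 i)"
    and sep: "separated k c b" and P: "distinct P" "set P \<inter> nodes k c b = {}"
    and len: "length E + length P = Suc (V !\<^sub>1 l + V !\<^sub>1 n)"
  shows "card (exts (nodes k c b \<union> set P) (constr k c b z \<union> rel_of (u # P @ [last E]))) =
    (\<Sum>M | length M = l - n \<and> sum_list M \<le> length P.
      (if k = 2 then 1 else \<L> (G (f k n l M (V, B)) (Std z))) *
      binom (int (length E) - 2 + int (length P) - int (sum_list M)) (length P - sum_list M) *
      (\<Prod>i = 1..l - n. ((B !\<^sub>1 (n - 1 + i) + M !\<^sub>1 i) choose (M !\<^sub>1 i))))"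
proof -
  have cb: "c n = [u]" "c l = E" "\<And>i. length (b i) = B !\<^sub>1 i"
    using nl by (simp_all add: c b std_link_def del: upt_Suc)
  have zk: "set z \<subseteq> {1..k}"
    using z by blast
  have "card (exts (nodes k c b \<union> set P) (constr k c b z \<union> rel_of (hd (c n) # P @ [last (c l)]))) =
    (\<Sum>M | length M = l - n \<and> sum_list M \<le> length P.
      count_exts k z (\<lambda>i. length (c i) + (if i = l then length P - sum_list M else 0))
        (\<lambda>i. length (b i) + (if n \<le> i \<and> i < l then M ! (i - n) else 0)) *
      binom (int (length (c l)) - 2 + int (length P) - int (sum_list M)) (length P - sum_list M) *
      (\<Prod>i<l - n. (length (b (n + i)) + M ! i) choose (M ! i)))"
    by (rule card_exts_sum[OF sep zk nl(1) _ nl(3) P]) (use nl in simp)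
  also have "\<dots> = (\<Sum>M | length M = l - n \<and> sum_list M \<le> length P.
      (if k = 2 then 1 else \<L> (G (f k n l M (V, B)) (Std z))) *
      binom (int (length E) - 2 + int (length P) - int (sum_list M)) (length P - sum_list M) *
      (\<Prod>i = 1..l - n. ((B !\<^sub>1 (n - 1 + i) + M !\<^sub>1 i) choose (M !\<^sub>1 i))))"
  proof (rule sum.cong[OF refl])
    fix M assume "M \<in> {M. length M = l - n \<and> sum_list M \<le> length P}"
    then have M: "length M = l - n" "sum_list M \<le> length P"
      by auto
    \<comment> \<open>This leaves at most v_l + v_n elements for \<open>P\<close>, so the truncated
      subtraction in \<open>f\<close> is exact.\<close>
    have "E \<noteq> []"
      using separatedD(1)[OF sep, of l] nl cb by simp
    then have le: "sum_list M \<le> V !\<^sub>1 l + V !\<^sub>1 n"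
      using M len by (cases E) auto
    have "length (c i) + (if i = l then length P - sum_list M else 0) =
        (if i = n then 1 else if i = l then Suc (V !\<^sub>1 l + V !\<^sub>1 n - sum_list M) else Suc (V !\<^sub>1 i))" for i
      using nl len M le by (auto simp: c std_chain_def Suc_diff_le simp del: upt_Suc)
    then have "count_exts k z (\<lambda>i. length (c i) + (if i = l then length P - sum_list M else 0))
        (\<lambda>i. length (b i) + (if n \<le> i \<and> i < l then M ! (i - n) else 0)) =
        (if k = 2 then 1 else \<L> (G (f k n l M (V, B)) (Std z)))"
      using count_exts_f[OF k nl M(1) le z] nl z by (simp only: cb) auto
    moreover have "(\<Prod>i<l - n. (length (b (n + i)) + M ! i) choose (M ! i)) =
        (\<Prod>i = 1..l - n. ((B !\<^sub>1 (n - 1 + i) + M !\<^sub>1 i) choose (M !\<^sub>1 i)))"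
    proof -
      obtain n' where "n = Suc n'"
        using nl(1) by (cases n) auto
      then show ?thesis
        unfolding One_nat_def prod.atLeast1_atMost_eq by (simp add: cb(3))
    qed
    ultimately show "count_exts k z (\<lambda>i. length (c i) + (if i = l then length P - sum_list M else 0))
        (\<lambda>i. length (b i) + (if n \<le> i \<and> i < l then M ! (i - n) else 0)) *
      binom (int (length (c l)) - 2 + int (length P) - int (sum_list M)) (length P - sum_list M) *
      (\<Prod>i<l - n. (length (b (n + i)) + M ! i) choose (M ! i)) =
      (if k = 2 then 1 else \<L> (G (f k n l M (V, B)) (Std z))) *
      binom (int (length E) - 2 + int (length P) - int (sum_list M)) (length P - sum_list M) *
      (\<Prod>i = 1..l - n. ((B !\<^sub>1 (n - 1 + i) + M !\<^sub>1 i) choose (M !\<^sub>1 i)))"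
      by (simp only: cb(2))
  qed
  finally show ?thesis
    by (simp only: cb list.sel)
qed

text \<open>Passes from the original system to one with a pendant chain. Links see only the least
  elements of chains, which do not change; so only the chains \<open>n\<close> and \<open>l\<close>
  and the order of the tops have to be compared, which is the assumption \<open>rel\<close>.\<close>

lemma exts_replace:
  assumes nl: "n \<in> {1..k}" "l \<in> {1..k}" "n \<noteq> l" and c': "c' = c(n := [u], l := E)"
    and rest: "set rest \<inter> {n, l} = {}"
    and hd: "hd (c n) = u" "hd E = hd (c l)"
    and sets: "set (c n) \<union> set (c l) = insert u (set P \<union> set E)"
    and rel: "\<And>R. trans R \<Longrightarrow> (u, u) \<in> R \<Longrightarrow>
      rel_of (c n) \<subseteq> R \<and> rel_of (c l) \<subseteq> R \<and> rel_of (map (\<lambda>i. last (c i)) ts) \<subseteq> R \<longleftrightarrow>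
      rel_of E \<subseteq> R \<and> rel_of (last E # map (\<lambda>i. last (c i)) rest) \<subseteq> R \<and> rel_of (u # P @ [last E]) \<subseteq> R"
  shows "exts (nodes k c b) (constr k c b ts) =
    exts (nodes k c' b \<union> set P) (constr k c' b (l # rest) \<union> rel_of (u # P @ [last E]))"
proof -
  have eq: "c' n = [u]" "c' l = E" "\<And>i. i \<in> {1..k} - {n, l} \<Longrightarrow> c' i = c i" "\<And>i. hd (c' i) = hd (c i)"
    using nl hd by (auto simp: c')
  have split: "(\<Union>i\<in>{1..k}. A i) = A n \<union> A l \<union> (\<Union>i\<in>{1..k} - {n, l}. A i)" for A :: "nat \<Rightarrow> 'a set"
    using nl by blast
  have "(\<Union>i\<in>{1..k}. set (c' i)) = insert u (set E) \<union> (\<Union>i\<in>{1..k} - {n, l}. set (c i))"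
    unfolding split[of "\<lambda>i. set (c' i)"] using eq by simp
  moreover have "(\<Union>i\<in>{1..k}. set (c i)) = insert u (set P \<union> set E) \<union> (\<Union>i\<in>{1..k} - {n, l}. set (c i))"
    unfolding split[of "\<lambda>i. set (c i)"] sets by simp
  ultimately have N: "nodes k c' b \<union> set P = nodes k c b"
    unfolding nodes_def by auto
  have u: "u \<in> nodes k c b"
    unfolding N[symmetric] using nl(1) eq(1) by (intro UnI1 nodesI(1)[of n]) simp_all
  have tops: "map (\<lambda>i. last (c' i)) (l # rest) = last E # map (\<lambda>i. last (c i)) rest"
    using rest nl by (auto simp: c')
  have splitA: "(\<forall>i\<in>{1..k}. A i) \<longleftrightarrow> A n \<and> A l \<and> (\<forall>i\<in>{1..k} - {n, l}. A i)" for A :: "nat \<Rightarrow> bool"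
    using nl by blast
  show ?thesis
    unfolding N
  proof (rule exts_cong)
    fix R assume R: "linear_order_on (nodes k c b) R"
    then have "trans R" and uu: "(u, u) \<in> R"
      using linear_order_on_refl[OF R u] by (simp_all add: linear_order_on_iff)
    note rel = rel[OF this]
    have "(\<forall>i\<in>{1..k} - {n, l}. rel_of (c' i) \<subseteq> R) \<longleftrightarrow> (\<forall>i\<in>{1..k} - {n, l}. rel_of (c i) \<subseteq> R)"
      using eq(3) by simp
    moreover have "rel_of [u] \<subseteq> R"
      using uu by simp
    ultimately show "constr k c b ts \<subseteq> R \<longleftrightarrow>
        constr k c' b (l # rest) \<union> rel_of (u # P @ [last E]) \<subseteq> R"
      unfolding Un_subset_iff constr_subset_iff splitA tops eq(1,2,4) using rel by argo
  qed
qed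

section \<open>The two possible orders of the first two tops\<close>

lemma std_chain_split:
  "std_chain (\<lambda>i. Suc (v i)) n = Chain n 0 # map (Chain n) [1..<Suc (v n)]"
  by (simp add: std_chain_def upt_conv_Cons del: upt_Suc)

text \<open>The top of the chain \<open>n\<close> comes first among the tops, directly before that
  of the chain \<open>l\<close>. So all of the chain \<open>n\<close> above \<open>u\<close> hangs
  below \<open>last (c l)\<close>, and \<open>E\<close> is the chain \<open>l\<close> itself, with
  inner number v_l - 1.\<close>

lemma count_exts_lower_first:
  fixes V B rest :: "nat list"
  assumes k: "2 \<le> k" "length V = k" "length B = k - 1" and nl: "1 \<le> n" "n < l" "l \<le> k"
    and ts: "distinct (n # l # rest)" "set (n # l # rest) = {1..k}"
  shows "count_exts k (n # l # rest) (\<lambda>i. Suc (V !\<^sub>1 i)) (\<lambda>i. B !\<^sub>1 i) =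
    (\<Sum>M | length M = l - n \<and> sum_list M \<le> V !\<^sub>1 n.
      (if k = 2 then 1 else \<L> (G (f k n l M (V, B)) (Std (l # rest)))) *
      binom (int (V !\<^sub>1 l) - 1 + int (V !\<^sub>1 n) - int (sum_list M)) (V !\<^sub>1 n - sum_list M) *
      (\<Prod>i = 1..l - n. ((B !\<^sub>1 (n - 1 + i) + M !\<^sub>1 i) choose (M !\<^sub>1 i))))"
proof -
  define c where "c = std_chain (\<lambda>i. Suc (V !\<^sub>1 i))"
  define b where "b = std_link (\<lambda>i. B !\<^sub>1 i)"
  define u where "u = Chain n 0"
  define P where "P = map (Chain n) [1..<Suc (V !\<^sub>1 n)]"
  define c' where "c' = c(n := [u], l := c l)"
  have sep: "separated k c b"
    unfolding c_def b_def by (rule separated_std) simp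
  have cn: "c n = u # P"
    unfolding c_def std_chain_split u_def P_def ..
  have in_k: "n \<in> {1..k}" "l \<in> {1..k}" "n \<noteq> l"
    using nl by auto
  have cl: "c l \<noteq> []"
    by (rule separatedD(1)[OF sep in_k(2)])
  have lenc: "length (c i) = Suc (V !\<^sub>1 i)" for i
    by (simp add: c_def std_chain_def del: upt_Suc)
  have lenP: "length P = V !\<^sub>1 n"
    by (simp add: P_def del: upt_Suc)
  have sub: "c' i \<noteq> [] \<and> distinct (c' i) \<and> set (c' i) \<subseteq> set (c i)" if "i \<in> {1..k}" for i
    using separatedD(1,2)[OF sep that] cn by (auto simp: c'_def)
  have sep': "separated k c' b"
    unfolding separated_def
  proof (intro conjI ballI impI)
    fix i j assume "i \<in> {1..k}" "j \<in> {1..k}" "i \<noteq> j"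
    then show "set (c' i) \<inter> set (c' j) = {}"
      using separatedD(4)[OF sep] sub by blast
  next
    fix i j assume "i \<in> {1..k}" "j \<in> {1..<k}"
    then show "set (c' i) \<inter> set (b j) = {}"
      using separatedD(6)[OF sep] sub by blast
  qed (use sub separatedD(3,5)[OF sep] in auto)
  have upper: "int (Suc (V !\<^sub>1 l)) - 2 + int (V !\<^sub>1 n) - s = int (V !\<^sub>1 l) - 1 + int (V !\<^sub>1 n) - s" for s
    by simp
  have P: "distinct P" "u \<notin> set P"
    using separatedD(2)[OF sep in_k(1)] cn by simp_all
  have "set P \<inter> set (c' i) = {}" if "i \<in> {1..k}" for i
  proof (cases "i = n")
    case True
    then show ?thesis using P in_k by (simp add: c'_def)
  next
    case False
    then show ?thesis
      using separatedD(4)[OF sep in_k(1) that] sub[OF that] cn by auto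
  qed
  moreover have "set P \<inter> set (b i) = {}" if "i \<in> {1..<k}" for i
    using separatedD(6)[OF sep in_k(1) that] cn by auto
  ultimately have disj: "set P \<inter> nodes k c' b = {}"
    by (simp add: nodes_def Int_Un_distrib Int_UN_distrib)
  have "exts (nodes k c b) (constr k c b (n # l # rest)) =
      exts (nodes k c' b \<union> set P) (constr k c' b (l # rest) \<union> rel_of (u # P @ [last (c l)]))"
  proof (rule exts_replace[OF in_k c'_def])
    show "set rest \<inter> {n, l} = {}"
      using ts(1) by auto
    fix R :: "node rel" assume R: "trans R"
    define T where "T = map (\<lambda>i. last (c i)) rest"
    \<comment> \<open>\<open>t\<close> is the top of the chain \<open>n\<close>, which is
      \<open>u\<close> itself if v_n = 0.\<close>
    obtain xs t where xs: "u # P = xs @ [t]"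
      by (metis append_butlast_last_id list.distinct(1))
    have uP: "u # P @ ys = xs @ t # ys" for ys
      using xs by (metis append_Cons append_Nil append_assoc)
    have tops: "map (\<lambda>i. last (c i)) (n # l # rest) = t # last (c l) # T"
      using cn xs by (simp add: T_def)
    show "rel_of (c n) \<subseteq> R \<and> rel_of (c l) \<subseteq> R \<and> rel_of (map (\<lambda>i. last (c i)) (n # l # rest)) \<subseteq> R \<longleftrightarrow>
      rel_of (c l) \<subseteq> R \<and> rel_of (last (c l) # map (\<lambda>i. last (c i)) rest) \<subseteq> R \<and>
      rel_of (u # P @ [last (c l)]) \<subseteq> R"
      \<comment> \<open>Apart from the chain \<open>l\<close>, both sides amount to the order of the
        one list \<open>xs @ t # last (c l) # T\<close>, split at \<open>t\<close> on the left and
        at \<open>last (c l)\<close> on the right.\<close>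
      using rel_of_join[OF R, of xs t "last (c l) # T"] rel_of_join[OF R, of "xs @ [t]" "last (c l)" T]
      unfolding tops cn T_def[symmetric] by (simp only: xs uP append_assoc append_Cons append_Nil) argo
  qed (use cn in auto)
  then have "count_exts k (n # l # rest) (\<lambda>i. Suc (V !\<^sub>1 i)) (\<lambda>i. B !\<^sub>1 i) =
      card (exts (nodes k c' b \<union> set P) (constr k c' b (l # rest) \<union> rel_of (u # P @ [last (c l)])))"
    by (simp only: count_exts_def c_def b_def)
  also have "\<dots> = (\<Sum>M | length M = l - n \<and> sum_list M \<le> length P.
      (if k = 2 then 1 else \<L> (G (f k n l M (V, B)) (Std (l # rest)))) *
      binom (int (length (c l)) - 2 + int (length P) - int (sum_list M)) (length P - sum_list M) *
      (\<Prod>i = 1..l - n. ((B !\<^sub>1 (n - 1 + i) + M !\<^sub>1 i) choose (M !\<^sub>1 i))))"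
  proof (rule card_exts_pendant_chain[OF k nl _ _ _ b_def sep' P(1) disj])
    show "distinct (l # rest)" "set (l # rest) = {1..k} - {n}"
      using ts by auto
    show "c' = (std_chain (\<lambda>i. Suc (V !\<^sub>1 i)))(n := [u], l := c l)"
      by (simp only: c'_def c_def)
    show "length (c l) + length P = Suc (V !\<^sub>1 l + V !\<^sub>1 n)"
      by (simp only: lenc lenP add_Suc)
  qed
  finally show ?thesis
    by (simp only: lenP lenc[of l] upper)
qed

text \<open>The top \<open>t\<close> of the chain \<open>n\<close> comes directly after the top of
  the chain \<open>l\<close>, so it can serve as a new top of that chain; this is \<open>E\<close>,
  with v_l + 2 elements and hence v_l inner ones. By \<open>Vn\<close> the elements \<open>u\<close>
  and \<open>t\<close> are distinct, and the v_n - 1 elements between them remain pendant below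
  \<open>t\<close>.\<close>

lemma count_exts_upper_first:
  fixes V B rest :: "nat list"
  assumes k: "2 \<le> k" "length V = k" "length B = k - 1" and nl: "1 \<le> n" "n < l" "l \<le> k"
    and ts: "distinct (l # n # rest)" "set (l # n # rest) = {1..k}" and Vn: "V !\<^sub>1 n \<noteq> 0"
  shows "count_exts k (l # n # rest) (\<lambda>i. Suc (V !\<^sub>1 i)) (\<lambda>i. B !\<^sub>1 i) =
    (\<Sum>M | length M = l - n \<and> sum_list M \<le> V !\<^sub>1 n - 1.
      (if k = 2 then 1 else \<L> (G (f k n l M (V, B)) (Std (l # rest)))) *
      binom (int (V !\<^sub>1 l) + int (V !\<^sub>1 n) - 1 - int (sum_list M)) (V !\<^sub>1 n - 1 - sum_list M) *
      (\<Prod>i = 1..l - n. ((B !\<^sub>1 (n - 1 + i) + M !\<^sub>1 i) choose (M !\<^sub>1 i))))"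
proof -
  define c where "c = std_chain (\<lambda>i. Suc (V !\<^sub>1 i))"
  define b where "b = std_link (\<lambda>i. B !\<^sub>1 i)"
  define u where "u = Chain n 0"
  define P where "P = map (Chain n) [1..<V !\<^sub>1 n]"
  define t where "t = Chain n (V !\<^sub>1 n)"
  define E where "E = c l @ [t]"
  define c' where "c' = c(n := [u], l := E)"
  have sep: "separated k c b"
    unfolding c_def b_def by (rule separated_std) simp
  have cn: "c n = u # P @ [t]"
    unfolding c_def std_chain_split u_def P_def t_def using Vn by simp
  have in_k: "n \<in> {1..k}" "l \<in> {1..k}" "n \<noteq> l"
    using nl by auto
  have cl: "c l \<noteq> []"
    by (rule separatedD(1)[OF sep in_k(2)])
  have lenc: "length (c i) = Suc (V !\<^sub>1 i)" for i
    by (simp add: c_def std_chain_def del: upt_Suc)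
  have lenP: "length P = V !\<^sub>1 n - 1"
    by (simp add: P_def)
  have upper: "int (V !\<^sub>1 l + 2) - 2 + int (V !\<^sub>1 n - 1) - s = int (V !\<^sub>1 l) + int (V !\<^sub>1 n) - 1 - s" for s
    using Vn by (simp add: of_nat_diff)
  have P: "distinct P" "u \<notin> set P" "t \<notin> set P" "t \<noteq> u"
    using separatedD(2)[OF sep in_k(1)] cn by auto
  have out: "x \<notin> set (c i)" if "x \<in> set (c n)" "i \<in> {1..k}" "i \<noteq> n" for x i
    using separatedD(4)[OF sep in_k(1) that(2)] that by blast
  have out_b: "x \<notin> set (b i)" if "x \<in> set (c n)" "i \<in> {1..<k}" for x i
    using separatedD(6)[OF sep in_k(1) that(2)] that by blast
  have sub: "set (c' i) \<subseteq> (if i = n then {u} else if i = l then insert t (set (c l)) else set (c i))" for i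
    using nl by (auto simp: c'_def E_def)
  have ne: "c' i \<noteq> [] \<and> distinct (c' i)" if "i \<in> {1..k}" for i
    using separatedD(1,2)[OF sep that] out[of t l] in_k cn by (auto simp: c'_def E_def)
  have sep': "separated k c' b"
    unfolding separated_def
  proof (intro conjI ballI impI)
    fix i j assume ij: "i \<in> {1..k}" "j \<in> {1..k}" "i \<noteq> j"
    have un: "u \<in> set (c n)" "t \<in> set (c n)"
      using cn by auto
    have *: "u \<notin> set (c i) \<and> t \<notin> set (c i)" if "i \<in> {1..k}" "i \<noteq> n" for i
      using out[OF un(1) that] out[OF un(2) that] by blast
    have c'n: "set (c' n) = {u}"
      using in_k by (simp add: c'_def)
    have sub1: "set (c' i) \<subseteq> insert t (set (c i))" if "i \<noteq> n" for i
      using sub[of i] that by (cases "i = l") auto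
    have sub2: "set (c' i) \<subseteq> set (c i)" if "i \<noteq> n" "i \<noteq> l" for i
      using sub[of i] that by simp
    \<comment> \<open>Apart from the chain \<open>n\<close>, only the chain \<open>l\<close> has
      changed, by the element \<open>t\<close>; so at least one of two such chains is as
      before.\<close>
    consider "i = n" | "j = n" | "i \<noteq> n" "j \<noteq> n" "i \<noteq> l" | "i \<noteq> n" "j \<noteq> n" "j \<noteq> l"
      using ij(3) by blast
    then show "set (c' i) \<inter> set (c' j) = {}"
    proof cases
      case 1
      then have "j \<noteq> n" using ij(3) by simp
      then show ?thesis
        unfolding 1 c'n using sub1[of j] *[OF ij(2)] P(4) by blast
    next
      case 2
      then have "i \<noteq> n" using ij(3) by simp
      then show ?thesis
        unfolding 2 c'n using sub1[of i] *[OF ij(1)] P(4) by blast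
    next
      case 3
      then show ?thesis
        using sub2[of i] sub1[of j] *[OF ij(1)] separatedD(4)[OF sep ij] by blast
    next
      case 4
      then show ?thesis
        using sub1[of i] sub2[of j] *[OF ij(2)] separatedD(4)[OF sep ij] by blast
    qed
  next
    fix i j assume ij: "i \<in> {1..k}" "j \<in> {1..<k}"
    have "u \<notin> set (b j)" "t \<notin> set (b j)"
      by (intro out_b[OF _ ij(2)]; simp add: cn)+
    then show "set (c' i) \<inter> set (b j) = {}"
      using sub[of i] separatedD(6)[OF sep ij] by (cases "i = n"; cases "i = l") auto
  qed (use ne separatedD(3,5)[OF sep] in auto)
  have "set P \<inter> set (c' i) = {}" if "i \<in> {1..k}" for i
  proof (cases "i = n")
    case True
    then show ?thesis using P in_k by (simp add: c'_def)
  next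
    case False
    then have "set P \<inter> set (c i) = {}"
      using out[OF _ that] cn by auto
    then show ?thesis
      using sub[of i] False P by (cases "i = l") auto
  qed
  moreover have "set P \<inter> set (b i) = {}" if "i \<in> {1..<k}" for i
    using out_b[OF _ that] cn by auto
  ultimately have disj: "set P \<inter> nodes k c' b = {}"
    by (simp add: nodes_def Int_Un_distrib Int_UN_distrib)
  have E: "last E = t" "length E = V !\<^sub>1 l + 2"
    by (simp_all add: E_def lenc)
  have "exts (nodes k c b) (constr k c b (l # n # rest)) =
      exts (nodes k c' b \<union> set P) (constr k c' b (l # rest) \<union> rel_of (u # P @ [last E]))"
  proof (rule exts_replace[OF in_k c'_def])
    show "set rest \<inter> {n, l} = {}"
      using ts(1) by auto
    fix R :: "node rel" assume R: "trans R"
    define T where "T = map (\<lambda>i. last (c i)) rest"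
    obtain ys z where ys: "c l = ys @ [z]"
      using cl by (metis append_butlast_last_id)
    have tops: "map (\<lambda>i. last (c i)) (l # n # rest) = z # t # T"
      using cn ys by (simp add: T_def)
    show "rel_of (c n) \<subseteq> R \<and> rel_of (c l) \<subseteq> R \<and> rel_of (map (\<lambda>i. last (c i)) (l # n # rest)) \<subseteq> R \<longleftrightarrow>
      rel_of E \<subseteq> R \<and> rel_of (last E # map (\<lambda>i. last (c i)) rest) \<subseteq> R \<and> rel_of (u # P @ [last E]) \<subseteq> R"
      \<comment> \<open>Here the common list is \<open>c l @ t # T\<close>, split at the old top
        \<open>z\<close> on the left and at \<open>t\<close> on the right.\<close>
      using rel_of_join[OF R, of ys z "t # T"] rel_of_join[OF R, of "ys @ [z]" t T]
      unfolding tops cn T_def[symmetric] E(1) by (simp only: E_def ys append_assoc append_Cons append_Nil) argo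
  qed (use cn cl in \<open>auto simp: E_def\<close>)
  then have "count_exts k (l # n # rest) (\<lambda>i. Suc (V !\<^sub>1 i)) (\<lambda>i. B !\<^sub>1 i) =
      card (exts (nodes k c' b \<union> set P) (constr k c' b (l # rest) \<union> rel_of (u # P @ [last E])))"
    by (simp only: count_exts_def c_def b_def)
  also have "\<dots> = (\<Sum>M | length M = l - n \<and> sum_list M \<le> length P.
      (if k = 2 then 1 else \<L> (G (f k n l M (V, B)) (Std (l # rest)))) *
      binom (int (length E) - 2 + int (length P) - int (sum_list M)) (length P - sum_list M) *
      (\<Prod>i = 1..l - n. ((B !\<^sub>1 (n - 1 + i) + M !\<^sub>1 i) choose (M !\<^sub>1 i))))"
  proof (rule card_exts_pendant_chain[OF k nl _ _ _ b_def sep' P(1) disj])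
    show "distinct (l # rest)" "set (l # rest) = {1..k} - {n}"
      using ts by auto
    show "c' = (std_chain (\<lambda>i. Suc (V !\<^sub>1 i)))(n := [u], l := E)"
      by (simp only: c'_def c_def)
    show "length E + length P = Suc (V !\<^sub>1 l + V !\<^sub>1 n)"
      using Vn by (simp add: E(2) lenP)
  qed
  finally show ?thesis
    by (simp only: lenP E(2) upper)
qed

theorem theorem5p6:
  fixes k :: nat and V B :: "nat list" and \<sigma> :: "nat \<Rightarrow> nat"
  assumes "k \<ge> 2"
    and "length V = k"
    and "length B = k - 1"
    and "\<sigma> permutes {1..k}"
    and "\<And>i j. 1 \<le> i \<Longrightarrow> i < j \<Longrightarrow> j \<le> k \<Longrightarrow> \<sigma> i > \<sigma> j \<Longrightarrow> V !\<^sub>1 \<sigma> j \<noteq> 0"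
  shows "(\<sigma> 1 < \<sigma> 2 \<longrightarrow>
      \<L> (G (V, B) \<sigma>) =
      (\<Sum>M | length M = \<sigma> 2 - \<sigma> 1 \<and> sum_list M \<le> V !\<^sub>1 \<sigma> 1.
        (if k = 2 then 1 else \<L> (G (f k (\<sigma> 1) (\<sigma> 2) M (V, B)) (Std (map \<sigma> [2..<k + 1]))))
        * binom (int (V !\<^sub>1 \<sigma> 2) - 1 + int (V !\<^sub>1 \<sigma> 1) - int (sum_list M)) (V !\<^sub>1 \<sigma> 1 - sum_list M)
        * (\<Prod>i = 1..\<sigma> 2 - \<sigma> 1. ((B !\<^sub>1 (\<sigma> 1 - 1 + i) + M !\<^sub>1 i) choose (M !\<^sub>1 i)))))
    \<and> (\<sigma> 2 < \<sigma> 1 \<longrightarrow>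
      \<L> (G (V, B) \<sigma>) =
      (\<Sum>M | length M = \<sigma> 1 - \<sigma> 2 \<and> sum_list M \<le> V !\<^sub>1 \<sigma> 2 - 1.
        (if k = 2 then 1 else \<L> (G (f k (\<sigma> 2) (\<sigma> 1) M (V, B)) (Std (\<sigma> 1 # map \<sigma> [3..<k + 1]))))
        * binom (int (V !\<^sub>1 \<sigma> 1) + int (V !\<^sub>1 \<sigma> 2) - 1 - int (sum_list M)) (V !\<^sub>1 \<sigma> 2 - 1 - sum_list M)
        * (\<Prod>i = 1..\<sigma> 1 - \<sigma> 2. ((B !\<^sub>1 (\<sigma> 2 - 1 + i) + M !\<^sub>1 i) choose (M !\<^sub>1 i)))))"
proof -
  have k: "2 \<le> k" "length V = k" "length B = k - 1"
    by fact+
  have range: "\<sigma> i \<in> {1..k}" if "i \<in> {1..k}" for i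
    using that by (simp only: permutes_in_image[OF assms(4)])
  \<comment> \<open>In both cases the word to be standardized is \<open>rest\<close> preceded by the
    larger of the first two entries of \<open>\<sigma>\<close>.\<close>
  define rest where "rest = map \<sigma> [3..<k + 1]"
  have "[1..<Suc k] = 1 # 2 # [3..<k + 1]"
    using k(1) by (simp add: upt_conv_Cons numeral_2_eq_2 numeral_3_eq_3 del: upt_Suc)
  then have tops: "map \<sigma> [1..<Suc k] = \<sigma> 1 # \<sigma> 2 # rest"
    by (simp only: rest_def list.map)
  have "[2..<k + 1] = 2 # [3..<k + 1]"
    using k(1) by (simp add: upt_conv_Cons numeral_2_eq_2 numeral_3_eq_3 del: upt_Suc)
  then have tops2: "map \<sigma> [2..<k + 1] = \<sigma> 2 # rest"
    by (simp only: rest_def list.map)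
  have "set (map \<sigma> [1..<Suc k]) = {1..k}"
    by (simp only: set_map set_upt atLeastLessThanSuc_atLeastAtMost permutes_image[OF assms(4)])
  moreover have "distinct (map \<sigma> [1..<Suc k])"
    using permutes_inj_on[OF assms(4)] by (simp only: distinct_map distinct_upt simp_thms)
  ultimately have ts: "distinct (\<sigma> 1 # \<sigma> 2 # rest)" "set (\<sigma> 1 # \<sigma> 2 # rest) = {1..k}"
    unfolding tops by auto
  have L: "\<L> (G (V, B) \<sigma>) = count_exts k (\<sigma> 1 # \<sigma> 2 # rest) (\<lambda>i. Suc (V !\<^sub>1 i)) (\<lambda>i. B !\<^sub>1 i)"
    using \<L>_G[OF k(2) range] by (simp only: tops)
  have "1 \<in> {1..k}" "2 \<in> {1..k}"
    using k(1) by auto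
  then have \<sigma>12: "1 \<le> \<sigma> 1" "\<sigma> 1 \<le> k" "1 \<le> \<sigma> 2" "\<sigma> 2 \<le> k"
    using range[of 1] range[of 2] by auto
  show ?thesis
  proof (intro conjI impI)
    assume less: "\<sigma> 1 < \<sigma> 2"
    show "\<L> (G (V, B) \<sigma>) =
      (\<Sum>M | length M = \<sigma> 2 - \<sigma> 1 \<and> sum_list M \<le> V !\<^sub>1 \<sigma> 1.
        (if k = 2 then 1 else \<L> (G (f k (\<sigma> 1) (\<sigma> 2) M (V, B)) (Std (map \<sigma> [2..<k + 1]))))
        * binom (int (V !\<^sub>1 \<sigma> 2) - 1 + int (V !\<^sub>1 \<sigma> 1) - int (sum_list M)) (V !\<^sub>1 \<sigma> 1 - sum_list M)
        * (\<Prod>i = 1..\<sigma> 2 - \<sigma> 1. ((B !\<^sub>1 (\<sigma> 1 - 1 + i) + M !\<^sub>1 i) choose (M !\<^sub>1 i))))"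
      unfolding L tops2 by (rule count_exts_lower_first[OF k \<sigma>12(1) less \<sigma>12(4) ts])
  next
    assume less: "\<sigma> 2 < \<sigma> 1"
    \<comment> \<open>The positions 1 and 2 form a descent, so the least and the greatest element of
      the chain \<open>\<sigma> 2\<close> differ.\<close>
    then have "V !\<^sub>1 \<sigma> 2 \<noteq> 0"
      using assms(5)[of 1 2] k(1) by simp
    then show "\<L> (G (V, B) \<sigma>) =
      (\<Sum>M | length M = \<sigma> 1 - \<sigma> 2 \<and> sum_list M \<le> V !\<^sub>1 \<sigma> 2 - 1.
        (if k = 2 then 1 else \<L> (G (f k (\<sigma> 2) (\<sigma> 1) M (V, B)) (Std (\<sigma> 1 # map \<sigma> [3..<k + 1]))))
        * binom (int (V !\<^sub>1 \<sigma> 1) + int (V !\<^sub>1 \<sigma> 2) - 1 - int (sum_list M)) (V !\<^sub>1 \<sigma> 2 - 1 - sum_list M)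
        * (\<Prod>i = 1..\<sigma> 1 - \<sigma> 2. ((B !\<^sub>1 (\<sigma> 2 - 1 + i) + M !\<^sub>1 i) choose (M !\<^sub>1 i))))"
      unfolding L rest_def[symmetric]
      by (rule count_exts_upper_first[OF k \<sigma>12(3) less \<sigma>12(2) ts])
  qed
qed

end
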